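(* Let $K$ be a field, $E$ a weighted graph, and $C$ an equivalence class of the relation $\leftrightharpoons$ on the objects of $\mathbf{RG}(E)$. Fix $(F,\phi)\in C$ and $u\in F^0$, and let $(T,\xi)=(T_C,\xi_C)$ be the representation graph constructed from $(F,\phi)$ and $u$. Then the right $L_K(E)$-module $V_T$ defined by $(T,\xi)$ is indecomposable.
   Context: Graphs: a directed graph $E=(E^0,E^1,r,s)$ consists of sets $E^0,E^1$ and maps $r,s:E^1\to E^0$ (range, source). All graphs are row-finite ($s^{-1}(v)$ finite for every vertex $v$). A weighted graph is such a graph $E$ with a map $w:E^1\to\mathbb N=\{1,2,\dots\}$. For $v\in E^0$, $w(v)=\max\{w(e)\mid e\in s^{-1}(v)\}$, and $w(v)=0$ if $v$ is a sink. The directed graph $\hat E$ has $\hat E^0=E^0$, $\hat E^1=\{e_1,\dots,e_{w(e)}\mid e\in E^1\}$, $\hat s(e_i)=s(e)$, $\hat r(e_i)=r(e)$; $\mathrm{tag}(e_i)=i$, $\mathrm{st}(e_i)=e$. Representation graphs: a representation graph of $E$ is a pair $(F,\phi)$, $F$ a directed graph and $\phi=(\phi^0,\phi^1):F\to\hat E$ a homomorphism of directed graphs, such that (1) for any $v\in F^0$ and $1\le i\le w(\phi^0(v))$ there is precisely one $f\in s_F^{-1}(v)$ with $\mathrm{tag}(\phi^1(f))=i$; (2) for any $v\in F^0$ and $e\in r^{-1}(\phi^0(v))$ there is precisely one $f\in r_F^{-1}(v)$ with $\mathrm{st}(\phi^1(f))=e$. Paths: the double graph $G_d$ of a directed graph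 $G$ is obtained by adding a reversed edge $g^*$ for each edge $g$ (with $(g^* )^*=g$). $\mathrm{Path}(G)$ is the set of finite paths of $G$ (vertices are paths of length $0$); ${}_u\mathrm{Path}(G)$ is the set of those starting at $u$. $\phi$ induces a map $\phi:\mathrm{Path}(F_d)\to\mathrm{Path}(\hat E_d)$. $F$ is connected if any two vertices are joined by a path in $F_d$. A path in $G_d$ is reduced if it contains no subword $gg^*$ or $g^*g$ with $g\in G^1$. Category: $\mathbf{RG}(E)$ is the category of nonempty connected representation graphs of $E$ (morphisms: graph homomorphisms commuting with the maps to $\hat E$). Write $(F,\phi)\leftrightharpoons(G,\psi)$ if there are $u\in F^0$, $v\in G^0$ with $\phi({}_u\mathrm{Path}(F_d))=\psi({}_v\mathrm{Path}(G_d))$; this is an equivalence relation. Construction of $(T_C,\xi_C)=(T,\xi)$: let $P=\phi({}_u\mathrm{Path}(F_d))_{\mathrm{nb}}$ be the set of reduced paths in $\phi({}_u\mathrm{Path}(F_d))\subseteq\mathrm{Path}(\hat E_d)$. Put $T^0=\{v_p\mid p\in P\}$, $T^1=\{e_p\mid p\in P, p\ne\phi(u)\}$. For $p=x_1\cdots x_n\in P$ of length $n\ge1$ (with $x_1\cdots x_{n-1}:=\phi(u)$ if $n=1$): if $x_n\in\hat E^1$, then $s(e_p)=v_{x_1\cdots x_{n-1}}$, $r(e_p)=v_p$, $\xi^1(e_p)=x_n$; if $x_n\in(\hat E^1)^*$, then $s(e_p)=v_p$, $r(e_p)=v_{x_1\cdots x_{n-1}}$, $\xi^1(e_p)=x_n^*$.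 Further $\xi^0(v_p)$ is the endpoint of $p$ in $\hat E_d$ (so $\xi^0(v_{\phi(u)})=\phi(u)$). This is a representation graph of $E$. Algebra: $L_K(E)$ is the (associative, not necessarily unital) $K$-algebra generated by $\{v,e_i,e_i^*\mid v\in E^0,e\in E^1,1\le i\le w(e)\}$ subject to: $uv=\delta_{uv}u$ for $u,v\in E^0$; $s(e)e_i=e_i=e_ir(e)$, $r(e)e_i^*=e_i^*=e_i^*s(e)$; $\sum_{1\le i\le w(v)}e_i^*f_i=\delta_{ef}r(e)$ for $v\in E^0$, $e,f\in s^{-1}(v)$; $\sum_{e\in s^{-1}(v)}e_ie_j^*=\delta_{ij}v$ for $v\in E^0$, $1\le i,j\le w(v)$; in the last two, $e_i=e_i^*=0$ if $i>w(e)$. Module: for a representation graph $(F,\phi)$, $V_F$ is the $K$-vector space with basis $F^0$ and right $L_K(E)$-action determined, for $v\in F^0$, by: $v\cdot u=v$ if $\phi^0(v)=u$ and $0$ otherwise ($u\in E^0$); $v\cdot e_i=r_F(f)$ if there is $f\in s_F^{-1}(v)$ with $\phi^1(f)=e_i$, and $0$ otherwise; $v\cdot e_i^*=s_F(f)$ if there is $f\in r_F^{-1}(v)$ with $\phi^1(f)=e_i$, and $0$ otherwise. A module is indecomposable if it is nonzero and is not a direct sum of two nonzero submodules. *)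

theory Defs
  imports "Graph_Theory.Arc_Walk" "HOL-Library.Poly_Mapping"
begin

section \<open>Weighted graphs and representation graphs\<close>

text \<open>
  Directed graphs are those of the AFP entry Graph_Theory: \<open>tail\<close> is the source map and
  \<open>head\<close> the range map.
\<close>

locale weighted_graph = wf_digraph E for E :: "('v, 'e) pre_digraph" +
  fixes w :: "'e \<Rightarrow> nat"
  assumes row_finite: "v \<in> verts E \<Longrightarrow> finite (out_arcs E v)"
    and weight_pos: "e \<in> arcs E \<Longrightarrow> 1 \<le> w e"

definition vertex_weight :: "('v, 'e) pre_digraph \<Rightarrow> ('e \<Rightarrow> nat) \<Rightarrow> 'v \<Rightarrow> nat" where
  "vertex_weight E w v = (if out_arcs E v = {} then 0 else Max (w ` out_arcs E v))"

text \<open>The edge \<open>e\<^sub>i\<close> of the directed graph \<open>hat E w\<close> is the pair \<open>(e, i)\<close>.\<close>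

definition hat :: "('v, 'e) pre_digraph \<Rightarrow> ('e \<Rightarrow> nat) \<Rightarrow> ('v, 'e \<times> nat) pre_digraph" where
  "hat E w = \<lparr>verts = verts E, arcs = {(e, i). e \<in> arcs E \<and> 1 \<le> i \<and> i \<le> w e},
     tail = tail E \<circ> fst, head = head E \<circ> fst\<rparr>"

abbreviation st :: "'e \<times> nat \<Rightarrow> 'e" where "st \<equiv> fst"
abbreviation tag :: "'e \<times> nat \<Rightarrow> nat" where "tag \<equiv> snd"

definition graph_hom ::
  "('a, 'b) pre_digraph \<Rightarrow> ('c, 'd) pre_digraph \<Rightarrow> ('a \<Rightarrow> 'c) \<times> ('b \<Rightarrow> 'd) \<Rightarrow> bool" where
  "graph_hom G H \<phi> \<longleftrightarrow>
     (\<forall>v\<in>verts G. fst \<phi> v \<in> verts H) \<and>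
     (\<forall>f\<in>arcs G. snd \<phi> f \<in> arcs H \<and>
        tail H (snd \<phi> f) = fst \<phi> (tail G f) \<and> head H (snd \<phi> f) = fst \<phi> (head G f))"

text \<open>A pair \<open>(F, \<phi>)\<close>, where \<open>\<phi> = (\<phi>\<^sup>0, \<phi>\<^sup>1)\<close> is to be a homomorphism from \<open>F\<close> to \<open>hat E w\<close>.\<close>

type_synonym ('x, 'y, 'v, 'e) rep_graph =
  "('x, 'y) pre_digraph \<times> ('x \<Rightarrow> 'v) \<times> ('y \<Rightarrow> 'e \<times> nat)"

definition representation_graph ::
  "('v, 'e) pre_digraph \<Rightarrow> ('e \<Rightarrow> nat) \<Rightarrow> ('x, 'y, 'v, 'e) rep_graph \<Rightarrow> bool" where
  "representation_graph E w = (\<lambda>(F, \<phi>0, \<phi>1).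
     wf_digraph F \<and> graph_hom F (hat E w) (\<phi>0, \<phi>1) \<and>
     (\<forall>v\<in>verts F. \<forall>i. 1 \<le> i \<and> i \<le> vertex_weight E w (\<phi>0 v) \<longrightarrow>
        (\<exists>!f. f \<in> out_arcs F v \<and> tag (\<phi>1 f) = i)) \<and>
     (\<forall>v\<in>verts F. \<forall>e\<in>in_arcs E (\<phi>0 v).
        (\<exists>!f. f \<in> in_arcs F v \<and> st (\<phi>1 f) = e)))"


section \<open>Paths in double graphs\<close>

text \<open>\<open>Fwd g\<close> is the edge \<open>g\<close> of \<open>G\<close> and \<open>Rev g\<close> the reversed edge \<open>g\<^sup>*\<close>.\<close>

datatype 'b darc = Fwd 'b | Rev 'b

definition double :: "('a, 'b) pre_digraph \<Rightarrow> ('a, 'b darc) pre_digraph" where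
  "double G = \<lparr>verts = verts G, arcs = Fwd ` arcs G \<union> Rev ` arcs G,
     tail = (\<lambda>d. case d of Fwd g \<Rightarrow> tail G g | Rev g \<Rightarrow> head G g),
     head = (\<lambda>d. case d of Fwd g \<Rightarrow> head G g | Rev g \<Rightarrow> tail G g)\<rparr>"

text \<open>
  A path is a pair consisting of its starting vertex and the list of its edges, so that the paths
  of length 0 are the pairs \<open>(v, [])\<close>.
\<close>

type_synonym ('a, 'b) path = "'a \<times> 'b list"

definition paths_from :: "('a, 'b) pre_digraph \<Rightarrow> 'a \<Rightarrow> ('a, 'b) path set" where
  "paths_from G u = {(u, p) | p. \<exists>v. pre_digraph.awalk G u p v}"

definition path_end :: "('a, 'b) pre_digraph \<Rightarrow> ('a, 'b) path \<Rightarrow> 'a" where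
  "path_end G p = pre_digraph.awlast G (fst p) (snd p)"

definition map_path ::
  "('a \<Rightarrow> 'c) \<times> ('b \<Rightarrow> 'd) \<Rightarrow> ('a, 'b darc) path \<Rightarrow> ('c, 'd darc) path" where
  "map_path \<phi> p = (fst \<phi> (fst p), map (map_darc (snd \<phi>)) (snd p))"

definition reduced :: "('a, 'b darc) path \<Rightarrow> bool" where
  "reduced p \<longleftrightarrow> \<not> (\<exists>xs g ys. snd p = xs @ [Fwd g, Rev g] @ ys \<or> snd p = xs @ [Rev g, Fwd g] @ ys)"

definition connected_graph :: "('a, 'b) pre_digraph \<Rightarrow> bool" where
  "connected_graph G \<longleftrightarrow>
     (\<forall>x\<in>verts G. \<forall>y\<in>verts G. \<exists>p. pre_digraph.awalk (double G) x p y)"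


section \<open>The objects of the category of representation graphs\<close>

text \<open>The vertices and edges of the objects are taken from the types \<open>'x\<close> and \<open>'y\<close>.\<close>

definition RG ::
  "('v, 'e) pre_digraph \<Rightarrow> ('e \<Rightarrow> nat) \<Rightarrow> ('x, 'y, 'v, 'e) rep_graph set" where
  "RG E w = {(F, \<phi>). representation_graph E w (F, \<phi>) \<and> verts F \<noteq> {} \<and> connected_graph F}"

definition RG_rel ::
  "('v, 'e) pre_digraph \<Rightarrow> ('e \<Rightarrow> nat) \<Rightarrow>
     (('x, 'y, 'v, 'e) rep_graph \<times> ('x, 'y, 'v, 'e) rep_graph) set" where
  "RG_rel E w = {((F, \<phi>), (G, \<psi>)). (F, \<phi>) \<in> RG E w \<and> (G, \<psi>) \<in> RG E w \<and>
     (\<exists>u\<in>verts F. \<exists>v\<in>verts G.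
        map_path \<phi> ` paths_from (double F) u = map_path \<psi> ` paths_from (double G) v)}"


section \<open>The representation graph \<open>T\<close>\<close>

definition reduced_image_paths ::
  "('x, 'y, 'v, 'e) rep_graph \<Rightarrow> 'x \<Rightarrow> ('v, ('e \<times> nat) darc) path set" where
  "reduced_image_paths = (\<lambda>(F, \<phi>) u. {p \<in> map_path \<phi> ` paths_from (double F) u. reduced p})"

text \<open>
  Both the vertex \<open>v\<^sub>p\<close> and the edge \<open>e\<^sub>p\<close> are represented by the path \<open>p\<close> itself.  The functions
  \<open>butlast\<close> and \<open>last\<close> take \<open>p = x\<^sub>1 \<dots> x\<^sub>n\<close> apart into \<open>x\<^sub>1 \<dots> x\<^sub>n\<^sub>-\<^sub>1\<close> and \<open>x\<^sub>n\<close>.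
\<close>

definition prefix_path :: "('a, 'b) path \<Rightarrow> ('a, 'b) path" where
  "prefix_path p = (fst p, butlast (snd p))"

definition T_graph ::
  "('v, 'e) pre_digraph \<Rightarrow> ('e \<Rightarrow> nat) \<Rightarrow> ('x, 'y, 'v, 'e) rep_graph \<Rightarrow> 'x \<Rightarrow>
     (('v, ('e \<times> nat) darc) path, ('v, ('e \<times> nat) darc) path, 'v, 'e) rep_graph" where
  "T_graph E w = (\<lambda>(F, \<phi>) u. let P = reduced_image_paths (F, \<phi>) u in
     (\<lparr>verts = P,
       arcs = P - {(fst \<phi> u, [])},
       tail = (\<lambda>p. case last (snd p) of Fwd x \<Rightarrow> prefix_path p | Rev x \<Rightarrow> p),
       head = (\<lambda>p. case last (snd p) of Fwd x \<Rightarrow> p | Rev x \<Rightarrow> prefix_path p)\<rparr>,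
      path_end (double (hat E w)),
      (\<lambda>p. case last (snd p) of Fwd x \<Rightarrow> x | Rev x \<Rightarrow> x)))"


section \<open>Weighted Leavitt path algebras\<close>

text \<open>
  The finitely supported functions from words over \<open>'g\<close> to a field form, with the convolution
  product of \<open>poly_mapping\<close>, the free unital associative algebra on \<open>'g\<close>; the empty word is \<open>0\<close>
  because the monoid of exponents is written additively.
\<close>

datatype 'g free_word = Word (letters: "'g list")

instantiation free_word :: (type) monoid_add
begin

definition zero_free_word :: "'a free_word" where
  "0 = Word []"

definition plus_free_word :: "'a free_word \<Rightarrow> 'a free_word \<Rightarrow> 'a free_word" where
  "a + b = Word (letters a @ letters b)"

instance
  by standard (simp_all add: zero_free_word_def plus_free_word_def)

end

type_synonym ('g, 'k) free_algebra = "'g free_word \<Rightarrow>\<^sub>0 'k"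

definition pm_scale :: "'k::field \<Rightarrow> ('b \<Rightarrow>\<^sub>0 'k) \<Rightarrow> ('b \<Rightarrow>\<^sub>0 'k)" where
  "pm_scale c = Poly_Mapping.map ((*) c)"

text \<open>\<open>GEdge e i\<close> is \<open>e\<^sub>i\<close> and \<open>GGhost e i\<close> is \<open>e\<^sub>i\<^sup>*\<close>.\<close>

datatype ('v, 'e) lpa_gen = GVert 'v | GEdge 'e nat | GGhost 'e nat

definition lpa_gens :: "('v, 'e) pre_digraph \<Rightarrow> ('e \<Rightarrow> nat) \<Rightarrow> ('v, 'e) lpa_gen set" where
  "lpa_gens E w = GVert ` verts E
     \<union> {GEdge e i | e i. e \<in> arcs E \<and> 1 \<le> i \<and> i \<le> w e}
     \<union> {GGhost e i | e i. e \<in> arcs E \<and> 1 \<le> i \<and> i \<le> w e}"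

text \<open>
  The free non-unital algebra on the generators: only nonempty words, all of whose letters are
  generators, occur.
\<close>

definition lpa_free ::
  "('v, 'e) pre_digraph \<Rightarrow> ('e \<Rightarrow> nat) \<Rightarrow> (('v, 'e) lpa_gen, 'k::field) free_algebra set" where
  "lpa_free E w = {a. \<forall>m\<in>Poly_Mapping.keys a. letters m \<noteq> [] \<and> set (letters m) \<subseteq> lpa_gens E w}"

definition xV :: "'v \<Rightarrow> (('v, 'e) lpa_gen, 'k::field) free_algebra" where
  "xV v = Poly_Mapping.single (Word [GVert v]) 1"

text \<open>The conventions \<open>e\<^sub>i = e\<^sub>i\<^sup>* = 0\<close> for \<open>i > w e\<close> are built into \<open>xE\<close> and \<open>xG\<close>.\<close>

definition xE :: "('e \<Rightarrow> nat) \<Rightarrow> 'e \<Rightarrow> nat \<Rightarrow> (('v, 'e) lpa_gen, 'k::field) free_algebra" where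
  "xE w e i = (if i \<le> w e then Poly_Mapping.single (Word [GEdge e i]) 1 else 0)"

definition xG :: "('e \<Rightarrow> nat) \<Rightarrow> 'e \<Rightarrow> nat \<Rightarrow> (('v, 'e) lpa_gen, 'k::field) free_algebra" where
  "xG w e i = (if i \<le> w e then Poly_Mapping.single (Word [GGhost e i]) 1 else 0)"

text \<open>A relation \<open>a = b\<close> is represented by \<open>a - b\<close>.\<close>

definition lpa_relators ::
  "('v, 'e) pre_digraph \<Rightarrow> ('e \<Rightarrow> nat) \<Rightarrow> (('v, 'e) lpa_gen, 'k::field) free_algebra set" where
  "lpa_relators E w =
     {xV u * xV v - (if u = v then xV u else 0) | u v. u \<in> verts E \<and> v \<in> verts E}
   \<union> {xV (tail E e) * xE w e i - xE w e i | e i. e \<in> arcs E \<and> 1 \<le> i \<and> i \<le> w e}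
   \<union> {xE w e i * xV (head E e) - xE w e i | e i. e \<in> arcs E \<and> 1 \<le> i \<and> i \<le> w e}
   \<union> {xV (head E e) * xG w e i - xG w e i | e i. e \<in> arcs E \<and> 1 \<le> i \<and> i \<le> w e}
   \<union> {xG w e i * xV (tail E e) - xG w e i | e i. e \<in> arcs E \<and> 1 \<le> i \<and> i \<le> w e}
   \<union> {(\<Sum>i = 1..vertex_weight E w v. xG w e i * xE w f i)
        - (if e = f then xV (head E e) else 0) | v e f.
        v \<in> verts E \<and> e \<in> out_arcs E v \<and> f \<in> out_arcs E v}
   \<union> {(\<Sum>e\<in>out_arcs E v. xE w e i * xG w e j) - (if i = j then xV v else 0) | v i j.
        v \<in> verts E \<and> 1 \<le> i \<and> i \<le> vertex_weight E w v \<and> 1 \<le> j \<and> j \<le> vertex_weight E w v}"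

text \<open>The two-sided ideal of the free non-unital algebra generated by the relators.\<close>

inductive_set lpa_ideal ::
  "('v, 'e) pre_digraph \<Rightarrow> ('e \<Rightarrow> nat) \<Rightarrow> (('v, 'e) lpa_gen, 'k::field) free_algebra set"
  for E :: "('v, 'e) pre_digraph" and w :: "'e \<Rightarrow> nat" where
  zero: "0 \<in> lpa_ideal E w"
| relator: "a \<in> lpa_relators E w \<Longrightarrow> a \<in> lpa_ideal E w"
| add: "a \<in> lpa_ideal E w \<Longrightarrow> b \<in> lpa_ideal E w \<Longrightarrow> a + b \<in> lpa_ideal E w"
| scale: "a \<in> lpa_ideal E w \<Longrightarrow> pm_scale c a \<in> lpa_ideal E w"
| mult_left: "a \<in> lpa_ideal E w \<Longrightarrow> b \<in> lpa_free E w \<Longrightarrow> b * a \<in> lpa_ideal E w"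
| mult_right: "a \<in> lpa_ideal E w \<Longrightarrow> b \<in> lpa_free E w \<Longrightarrow> a * b \<in> lpa_ideal E w"

definition lpa_class ::
  "('v, 'e) pre_digraph \<Rightarrow> ('e \<Rightarrow> nat) \<Rightarrow> (('v, 'e) lpa_gen, 'k::field) free_algebra \<Rightarrow>
     (('v, 'e) lpa_gen, 'k) free_algebra set" where
  "lpa_class E w a = {b \<in> lpa_free E w. b - a \<in> lpa_ideal E w}"

record ('k, 'a) nonunital_algebra =
  alg_carrier :: "'a set"
  alg_add :: "'a \<Rightarrow> 'a \<Rightarrow> 'a"
  alg_mult :: "'a \<Rightarrow> 'a \<Rightarrow> 'a"
  alg_scale :: "'k \<Rightarrow> 'a \<Rightarrow> 'a"

text \<open>The algebra \<open>L\<^sub>K(E)\<close>; its elements are the cosets of the ideal of relations.\<close>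

definition LPA ::
  "('v, 'e) pre_digraph \<Rightarrow> ('e \<Rightarrow> nat) \<Rightarrow>
     ('k::field, (('v, 'e) lpa_gen, 'k) free_algebra set) nonunital_algebra" where
  "LPA E w =
     \<lparr>alg_carrier = lpa_class E w ` lpa_free E w,
      alg_add = (\<lambda>X Y. \<Union>a\<in>X. \<Union>b\<in>Y. lpa_class E w (a + b)),
      alg_mult = (\<lambda>X Y. \<Union>a\<in>X. \<Union>b\<in>Y. lpa_class E w (a * b)),
      alg_scale = (\<lambda>c X. \<Union>a\<in>X. lpa_class E w (pm_scale c a))\<rparr>"


section \<open>Right modules and indecomposability\<close>

locale right_module = vector_space scale
  for L :: "('k::field, 'a) nonunital_algebra"
    and M :: "'m::ab_group_add set"
    and scale :: "'k \<Rightarrow> 'm \<Rightarrow> 'm"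
    and act :: "'m \<Rightarrow> 'a \<Rightarrow> 'm" +
  assumes subspace_M: "subspace M"
    and act_closed: "x \<in> M \<Longrightarrow> l \<in> alg_carrier L \<Longrightarrow> act x l \<in> M"
    and act_add_left: "x \<in> M \<Longrightarrow> y \<in> M \<Longrightarrow> l \<in> alg_carrier L \<Longrightarrow>
      act (x + y) l = act x l + act y l"
    and act_add_right: "x \<in> M \<Longrightarrow> l \<in> alg_carrier L \<Longrightarrow> m \<in> alg_carrier L \<Longrightarrow>
      act x (alg_add L l m) = act x l + act x m"
    and act_mult: "x \<in> M \<Longrightarrow> l \<in> alg_carrier L \<Longrightarrow> m \<in> alg_carrier L \<Longrightarrow>
      act x (alg_mult L l m) = act (act x l) m"
    and act_scale_left: "x \<in> M \<Longrightarrow> l \<in> alg_carrier L \<Longrightarrow> act (scale c x) l = scale c (act x l)"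
    and act_scale_right: "x \<in> M \<Longrightarrow> l \<in> alg_carrier L \<Longrightarrow>
      act x (alg_scale L c l) = scale c (act x l)"
begin

definition submodule :: "'m set \<Rightarrow> bool" where
  "submodule N \<longleftrightarrow> subspace N \<and> N \<subseteq> M \<and> (\<forall>x\<in>N. \<forall>l\<in>alg_carrier L. act x l \<in> N)"

end

locale indecomposable_right_module = right_module +
  assumes nonzero: "M \<noteq> {0}"
    and indecomposable: "submodule N\<^sub>1 \<Longrightarrow> submodule N\<^sub>2 \<Longrightarrow>
      M = {x + y | x y. x \<in> N\<^sub>1 \<and> y \<in> N\<^sub>2} \<Longrightarrow> N\<^sub>1 \<inter> N\<^sub>2 = {0} \<Longrightarrow> N\<^sub>1 = {0} \<or> N\<^sub>2 = {0}"


section \<open>The module of a representation graph\<close>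

text \<open>The vector space with basis \<open>verts F\<close>; the basis vector \<open>v\<close> is \<open>Poly_Mapping.single v 1\<close>.\<close>

definition V_carrier :: "('x, 'y, 'v, 'e) rep_graph \<Rightarrow> ('x \<Rightarrow>\<^sub>0 'k::field) set" where
  "V_carrier = (\<lambda>(F, \<phi>). {x. Poly_Mapping.keys x \<subseteq> verts F})"

primrec gen_act :: "('x, 'y, 'v, 'e) rep_graph \<Rightarrow> 'x \<Rightarrow> ('v, 'e) lpa_gen \<Rightarrow> 'x \<Rightarrow>\<^sub>0 'k::field" where
  "gen_act R v (GVert u) =
     (case R of (F, \<phi>0, \<phi>1) \<Rightarrow> if \<phi>0 v = u then Poly_Mapping.single v 1 else 0)"
| "gen_act R v (GEdge e i) =
     (case R of (F, \<phi>0, \<phi>1) \<Rightarrow>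
        if \<exists>f\<in>out_arcs F v. \<phi>1 f = (e, i)
        then Poly_Mapping.single (head F (THE f. f \<in> out_arcs F v \<and> \<phi>1 f = (e, i))) 1 else 0)"
| "gen_act R v (GGhost e i) =
     (case R of (F, \<phi>0, \<phi>1) \<Rightarrow>
        if \<exists>f\<in>in_arcs F v. \<phi>1 f = (e, i)
        then Poly_Mapping.single (tail F (THE f. f \<in> in_arcs F v \<and> \<phi>1 f = (e, i))) 1 else 0)"

text \<open>
  Linear extension of \<open>gen_act\<close> in the vector, then extension to words (letters act from left to
  right, this being a right action), to the free algebra, and to cosets.
\<close>

definition gen_act_lin ::
  "('x, 'y, 'v, 'e) rep_graph \<Rightarrow> ('x \<Rightarrow>\<^sub>0 'k::field) \<Rightarrow> ('v, 'e) lpa_gen \<Rightarrow> 'x \<Rightarrow>\<^sub>0 'k" where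
  "gen_act_lin R x g =
     (\<Sum>v\<in>Poly_Mapping.keys x. pm_scale (Poly_Mapping.lookup x v) (gen_act R v g))"

definition free_act ::
  "('x, 'y, 'v, 'e) rep_graph \<Rightarrow> ('x \<Rightarrow>\<^sub>0 'k::field) \<Rightarrow> (('v, 'e) lpa_gen, 'k) free_algebra \<Rightarrow>
     'x \<Rightarrow>\<^sub>0 'k" where
  "free_act R x a = (\<Sum>m\<in>Poly_Mapping.keys a.
     pm_scale (Poly_Mapping.lookup a m) (foldl (gen_act_lin R) x (letters m)))"

definition V_act ::
  "('x, 'y, 'v, 'e) rep_graph \<Rightarrow> ('x \<Rightarrow>\<^sub>0 'k::field) \<Rightarrow> (('v, 'e) lpa_gen, 'k) free_algebra set \<Rightarrow>
     'x \<Rightarrow>\<^sub>0 'k" where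
  "V_act R x X = (THE y. \<forall>a\<in>X. free_act R x a = y)"

end

theory Submission
  imports Defs
begin

text \<open>
  A path in the double graph of a representation graph is determined by its starting vertex and
  the word of its labels, because the defining properties make the edge with a given label
  unique, in both directions. So a word of labels acts as a partial injective map on the
  vertices, and the relations of the algebra only say how these partial maps fit together. For
  the tree \<open>T\<close> the vertices are themselves reduced words, and reading a word \<open>q\<close> at the vertex \<open>p\<close>
  leads to the reduced form of \<open>p q\<close>, the product in the free group on the labels.

  Let the module be the direct sum of nonzero submodules \<open>N\<^sub>1\<close> and \<open>N\<^sub>2\<close>, and decompose the root as
  \<open>x + y\<close>. Since the root generates the module, \<open>x\<close> and \<open>y\<close> are nonzero. A monomial that
  annihilates the root annihilates \<open>x\<close> and \<open>y\<close>; as monomials act injectively on the vertices they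
  do not kill, every word readable at a vertex in the support of \<open>x\<close> is readable at the root. The
  axioms of a representation graph turn this inclusion into an equality
  (\<open>run_readable_mono\<close>, \<open>component_support\<close>). So the words readable at the root, in particular the
  vertices \<open>q\<close> in the support of \<open>y\<close>, are readable at each \<open>p\<close> in the support of \<open>x\<close> and lead to
  \<open>p q\<close>.

  Now let each vertex \<open>q\<close> in the support of \<open>y\<close> act on \<open>x\<close> as a word, with its coefficient. The
  resulting vector \<open>z\<close> lies in \<open>N\<^sub>1\<close>. The same operation applied to \<open>x + y\<close>, the root, gives \<open>y\<close>, so
  \<open>z\<close> also equals \<open>y\<close> minus an element of \<open>N\<^sub>2\<close>. Hence \<open>z = 0\<close>. On the other hand, \<open>z\<close> is the product
  of \<open>x\<close> and \<open>y\<close> in the group algebra of the free group. This is nonzero: among the products of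
  the two supports one is attained only once (\<open>unique_product\<close>).

  The unique product property follows from an order on the free group that is invariant under left
  multiplication. The order used here compares \<open>u\<close> and \<open>v\<close> by an odd integer attached to the walk
  from \<open>u\<close> to \<open>v\<close> in the tree of reduced words, which counts signs of edges and signs of turns.
  Reversing a walk changes the sign, and the integers for the three sides of a triangle add up to
  0, 1 or -1, because all contributions cancel except the turns at the centre of the triangle. So
  positivity is transitive.
\<close>


section \<open>Words over an alphabet with formal inverses\<close>

primrec dual :: "'b darc \<Rightarrow> 'b darc" where
  "dual (Fwd a) = Rev a"
| "dual (Rev a) = Fwd a"

lemma dual_dual [simp]: "dual (dual d) = d"
  by (cases d) auto

lemma dual_eq_iff [simp]: "dual c = dual d \<longleftrightarrow> c = d"
  by (metis dual_dual)

definition reduced_word :: "'b darc list \<Rightarrow> bool" where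
  "reduced_word = successively (\<lambda>c d. d \<noteq> dual c)"

lemma reduced_word_Nil [simp]: "reduced_word []"
  by (simp add: reduced_word_def)

lemma reduced_word_Cons:
  "reduced_word (d # ds) \<longleftrightarrow> ds = [] \<or> hd ds \<noteq> dual d \<and> reduced_word ds"
  by (auto simp: reduced_word_def successively_Cons)

lemma reduced_word_snoc:
  "reduced_word (ds @ [d]) \<longleftrightarrow> reduced_word ds \<and> (ds = [] \<or> last ds \<noteq> dual d)"
  by (auto simp: reduced_word_def successively_append_iff)

lemma reduced_word_butlast: "reduced_word ds \<Longrightarrow> reduced_word (butlast ds)"
  by (cases ds rule: rev_cases) (auto simp: reduced_word_snoc)

lemma reduced_iff_reduced_word: "reduced p \<longleftrightarrow> reduced_word (snd p)"
proof -
  have cancel: "reduced_word (xs @ [c, d] @ ys) \<Longrightarrow> d \<noteq> dual c" for xs ys c d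
    by (simp add: reduced_word_def successively_append_iff)
  have "reduced_word ds" if "\<And>xs c ys. ds \<noteq> xs @ [c, dual c] @ ys" for ds
    using that
  proof (induction ds)
    case (Cons d ds)
    have "reduced_word ds"
      by (rule Cons.IH) (use Cons.prems[of "d # _"] in auto)
    moreover have "hd ds \<noteq> dual d" if "ds \<noteq> []"
      using Cons.prems[of "[]" d "tl ds"] that by (cases ds) auto
    ultimately show ?case
      by (auto simp: reduced_word_Cons)
  qed simp
  moreover have "reduced p \<longleftrightarrow> (\<forall>xs c ys. snd p \<noteq> xs @ [c, dual c] @ ys)"
    unfolding reduced_def by (metis darc.exhaust dual.simps)
  ultimately show ?thesis
    using cancel by metis
qed

text \<open>
  The reduced words are the elements of the free group; \<open>mult_letter\<close> and \<open>letter_mult\<close> are the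
  multiplications by a letter on the right and on the left.
\<close>

definition mult_letter :: "'b darc list \<Rightarrow> 'b darc \<Rightarrow> 'b darc list" where
  "mult_letter ds d = (if ds \<noteq> [] \<and> last ds = dual d then butlast ds else ds @ [d])"

definition letter_mult :: "'b darc \<Rightarrow> 'b darc list \<Rightarrow> 'b darc list" where
  "letter_mult d ds = (if ds \<noteq> [] \<and> hd ds = dual d then tl ds else d # ds)"

abbreviation mult_word :: "'b darc list \<Rightarrow> 'b darc list \<Rightarrow> 'b darc list" where
  "mult_word \<equiv> foldl mult_letter"

lemma reduced_mult_letter: "reduced_word ds \<Longrightarrow> reduced_word (mult_letter ds d)"
  by (auto simp: mult_letter_def reduced_word_snoc reduced_word_butlast)

lemma reduced_letter_mult: "reduced_word ds \<Longrightarrow> reduced_word (letter_mult d ds)"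
  by (cases ds) (auto simp: letter_mult_def reduced_word_Cons)

lemma reduced_mult_word: "reduced_word u \<Longrightarrow> reduced_word (mult_word u v)"
  by (induction v arbitrary: u) (auto simp: reduced_mult_letter)

lemma mult_letter_dual:
  assumes "reduced_word ds"
  shows "mult_letter (mult_letter ds d) (dual d) = ds"
proof (cases ds rule: rev_cases)
  case Nil
  then show ?thesis by (simp add: mult_letter_def)
next
  case (snoc es e)
  show ?thesis
  proof (cases "e = dual d")
    case True
    then show ?thesis
      using assms by (auto simp: snoc mult_letter_def reduced_word_snoc)
  qed (simp add: snoc mult_letter_def butlast_append)
qed

lemma mult_word_cancel_right:
  assumes "reduced_word u" "reduced_word u'" "mult_word u v = mult_word u' v"
  shows "u = u'"
  using assms
proof (induction v arbitrary: u u')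
  case (Cons d v)
  then have "mult_letter u d = mult_letter u' d"
    by (simp add: reduced_mult_letter)
  then show ?case
    using Cons.prems by (metis mult_letter_dual)
qed simp

lemma mult_word_Nil_left: "reduced_word v \<Longrightarrow> mult_word [] v = v"
proof (induction v rule: rev_induct)
  case (snoc d v)
  then show ?case
    by (auto simp: reduced_word_snoc mult_letter_def)
qed simp

lemma mult_letter_letter_mult: "mult_letter (letter_mult c ds) d = letter_mult c (mult_letter ds d)"
proof (cases ds)
  case Nil
  then show ?thesis by (auto simp: mult_letter_def letter_mult_def)
next
  case (Cons e es)
  then show ?thesis by (cases es) (auto simp: mult_letter_def letter_mult_def)
qed

lemma mult_word_letter_mult: "mult_word (letter_mult c u) v = letter_mult c (mult_word u v)"
  by (induction v arbitrary: u) (simp_all add: mult_letter_letter_mult)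

lemma foldr_letter_mult_Nil: "reduced_word u \<Longrightarrow> foldr letter_mult u [] = u"
proof (induction u)
  case (Cons d u)
  then show ?case by (cases u) (auto simp: reduced_word_Cons letter_mult_def)
qed simp

text \<open>
  Letters acting from the left commute with letters acting from the right, so \<open>u v\<close> can also be
  computed by letting the letters of \<open>u\<close> act from the left. This reduces invariance under left
  multiplication to the case of a single letter.
\<close>

lemma mult_word_conv_foldr:
  assumes "reduced_word u" "reduced_word v"
  shows "mult_word u v = foldr letter_mult u v"
proof -
  have "foldr letter_mult us (mult_word [] v) = mult_word (foldr letter_mult us []) v" for us
    by (induction us) (simp_all add: mult_word_letter_mult)
  then show ?thesis
    using assms by (metis foldr_letter_mult_Nil mult_word_Nil_left)
qed


section \<open>A left-invariant order on reduced words\<close>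

locale ordered_letters =
  fixes r :: "'b darc rel"
  assumes linear: "linear_order r"
begin

definition turn :: "'b darc \<Rightarrow> 'b darc \<Rightarrow> int" where
  "turn c d = (if c = d then 0 else if (c, d) \<in> r then 1 else -1)"

lemma turn_antisym: "turn d c = - turn c d"
  using linear
  by (auto simp: turn_def linear_order_on_def partial_order_on_def antisym_def total_on_def)

lemma turn_cyclic: "\<bar>turn b c + turn c d + turn d b\<bar> \<le> 1"
proof -
  have trans: "(x, y) \<in> r \<Longrightarrow> (y, z) \<in> r \<Longrightarrow> (x, z) \<in> r" for x y z
    using linear unfolding linear_order_on_def partial_order_on_def preorder_on_def
    by (meson transD)
  have total: "x = y \<or> (x, y) \<in> r \<or> (y, x) \<in> r" for x y
    using linear by (auto simp: linear_order_on_def total_on_def)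
  have antisym: "x = y" if "(x, y) \<in> r" "(y, x) \<in> r" for x y
    using linear that unfolding linear_order_on_def partial_order_on_def by (meson antisymD)
  have "turn b c = 0 \<or> turn c d = 0 \<or> turn d b = 0 \<or> \<not> (turn b c = turn c d \<and> turn c d = turn d b)"
  proof (rule ccontr)
    assume "\<not> ?thesis"
    then have distinct: "b \<noteq> c" "c \<noteq> d" "d \<noteq> b"
      and same: "turn b c = turn c d" "turn c d = turn d b"
      by (auto simp: turn_def)
    then have "(b, c) \<in> r \<longleftrightarrow> (c, d) \<in> r" "(c, d) \<in> r \<longleftrightarrow> (d, b) \<in> r"
      by (simp_all add: turn_def split: if_splits)
    then show False
      using distinct trans[of b c d] trans[of d c b] antisym[of b d] total[of b c] total[of c d]
        total[of d b] by argo
  qed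
  then show ?thesis
    using antisym[of b c] antisym[of c d] antisym[of d b] total[of b c] total[of c d] total[of d b]
    by (auto simp: turn_def split: if_splits)
qed

lemma odd_turn: "c \<noteq> d \<Longrightarrow> odd (turn c d)"
  by (simp add: turn_def)

lemma turn_self [simp]: "turn c c = 0"
  by (simp add: turn_def)

fun hd_turn :: "'b darc list \<Rightarrow> 'b darc list \<Rightarrow> int" where
  "hd_turn (c # cs) (d # ds) = turn c d"
| "hd_turn _ _ = 0"

lemma hd_turn_Nil [simp]: "hd_turn cs [] = 0"
  by (cases cs) auto

lemma hd_turn_antisym: "hd_turn ds cs = - hd_turn cs ds"
  by (cases cs; cases ds) (auto intro: turn_antisym)

lemma abs_turn: "\<bar>turn c d\<bar> \<le> 1"
  by (simp add: turn_def)

lemma hd_turn_cyclic: "\<bar>hd_turn bs cs + hd_turn cs ds + hd_turn ds bs\<bar> \<le> 1"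
  by (cases bs; cases cs; cases ds) (auto simp: turn_cyclic abs_turn)

primrec sign :: "'b darc \<Rightarrow> int" where
  "sign (Fwd a) = 1"
| "sign (Rev a) = -1"

lemma sign_dual [simp]: "sign (dual d) = - sign d"
  by (cases d) auto

lemma odd_sign: "odd (sign d)"
  by (cases d) auto

text \<open>
  A word is a walk in the tree of all reduced words. Each step contributes its sign, and each
  passage through a vertex between two steps contributes the turn from the direction pointing
  back to the direction pointing onwards. The reversed walk has the opposite height.
\<close>

fun height :: "'b darc list \<Rightarrow> int" where
  "height [] = 0"
| "height (d # ds) = sign d + hd_turn [dual d] ds + height ds"

text \<open>
  The height of the walk from \<open>u\<close> to \<open>v\<close>, that is, of the reduced form of \<open>u\<^sup>-\<^sup>1 v\<close>: the common
  prefix of \<open>u\<close> and \<open>v\<close> is removed, the rest of \<open>u\<close> is traversed backwards, and the rest of \<open>v\<close>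
  forwards, with one turn in between.
\<close>

fun gap :: "'b darc list \<Rightarrow> 'b darc list \<Rightarrow> int" where
  "gap (c # u) (d # v) =
     (if c = d then gap u v else turn c d + height (d # v) - height (c # u))"
| "gap u v = height v - height u"

lemma gap_distinct_heads:
  "u = [] \<or> v = [] \<or> hd u \<noteq> hd v \<Longrightarrow> gap u v = hd_turn u v + height v - height u"
  by (cases u; cases v) auto

lemma gap_antisym: "gap v u = - gap u v"
proof (induction u v rule: gap.induct)
  case (1 c u d v)
  then show ?case
    using turn_antisym[of c d] by auto
next
  case ("2_1" v)
  then show ?case
    by (cases v) auto
qed simp

lemma gap_self [simp]: "gap u u = 0"
  by (induction u) auto

text \<open>
  A walk with \<open>n\<close> steps has \<open>n - 1\<close> proper turns. Hence its height is a sum of \<open>2 n - 1\<close> terms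
  \<open>\<plusminus>1\<close> and cannot vanish.
\<close>

lemma odd_height: "reduced_word u \<Longrightarrow> u \<noteq> [] \<Longrightarrow> odd (height u)"
proof (induction u)
  case (Cons d u)
  show ?case
  proof (cases u)
    case Nil
    then show ?thesis by (simp add: odd_sign)
  next
    case (Cons e es)
    then show ?thesis
      using Cons.IH Cons.prems odd_sign[of d] odd_turn[of "dual d" e]
      by (auto simp: reduced_word_Cons)
  qed
qed simp

lemma odd_gap:
  assumes "reduced_word u" "reduced_word v" "u \<noteq> v"
  shows "odd (gap u v)"
  using assms
proof (induction u v rule: gap.induct)
  case (1 c u d v)
  show ?case
  proof (cases "c = d")
    case True
    then show ?thesis
      using 1 by (auto simp: reduced_word_Cons)
  next
    case False
    then show ?thesis
      using odd_turn[of c d] odd_height[of "c # u"] odd_height[of "d # v"] 1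
      by (auto simp del: height.simps)
  qed
qed (use odd_height in \<open>auto simp del: height.simps(2)\<close>)

text \<open>
  The walk from \<open>u\<close> to \<open>v\<close> and the walks from the root to \<open>u\<close> and to \<open>v\<close> meet in one vertex. The
  turns at this vertex are the only contributions that do not cancel. The word \<open>z\<close> stands for a
  further direction at the root, which becomes the direction back when a common first letter is
  removed.
\<close>

lemma gap_near_height_diff:
  "\<bar>gap u v + (height u + hd_turn z u) - (height v + hd_turn z v)\<bar> \<le> 1"
proof (induction u v arbitrary: z rule: gap.induct)
  case (1 c u d v)
  show ?case
  proof (cases "c = d")
    case True
    then show ?thesis
      using "1.IH"[OF True, of "[dual c]"] by (cases z) (simp_all add: algebra_simps)
  next
    case False
    have "\<bar>hd_turn (c # u) (d # v) + hd_turn (d # v) z + hd_turn z (c # u)\<bar> \<le> 1"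
      by (rule hd_turn_cyclic)
    then show ?thesis
      using False hd_turn_antisym[of z "d # v"] by (simp del: height.simps)
  qed
next
  case ("2_1" v)
  then show ?case
    using hd_turn_cyclic[of z v "[]"] by simp
next
  case ("2_2" u)
  then show ?case
    using hd_turn_cyclic[of z u "[]"] by simp
qed

lemma gap_cyclic: "\<bar>gap u v + gap v x + gap x u\<bar> \<le> 1"
proof (induction u arbitrary: v x)
  case Nil
  have "gap [] v = height v" "gap x [] = - height x"
    by (cases v; simp) (cases x; simp)
  then show ?case
    using gap_near_height_diff[of v x "[]"] by simp
next
  case (Cons c u)
  have near: "\<bar>gap y z + gap z t + gap t y\<bar> \<le> 1"
    if "y = [] \<or> t = [] \<or> hd y \<noteq> hd t" "z = [] \<or> t = [] \<or> hd z \<noteq> hd t" for y z t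
  proof -
    have "gap t y = - (hd_turn y t + height t - height y)"
      using gap_distinct_heads[OF that(1)] gap_antisym by metis
    moreover have "gap z t = hd_turn z t + height t - height z"
      using gap_distinct_heads[OF that(2)] by metis
    ultimately show ?thesis
      using gap_near_height_diff[of y z t] hd_turn_antisym[of t y] hd_turn_antisym[of t z] by simp
  qed
  show ?case
  proof (cases "v \<noteq> [] \<and> x \<noteq> [] \<and> hd v = c \<and> hd x = c")
    case True
    then obtain v' x' where "v = c # v'" "x = c # x'"
      by (metis list.collapse)
    then show ?thesis
      using Cons.IH[of v' x'] by simp
  next
    case False
    let ?apart = "\<lambda>y t :: 'b darc list. y = [] \<or> t = [] \<or> hd y \<noteq> hd t"
    from False consider "?apart (c # u) x" "?apart v x" | "?apart v (c # u)" "?apart x (c # u)"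
      | "?apart x v" "?apart (c # u) v"
      by (metis list.sel(1))
    then show ?thesis
      using near[of "c # u" x v] near[of v "c # u" x] near[of x v "c # u"]
      by cases (simp_all add: add_ac)
  qed
qed

text \<open>
  If \<open>gap u v\<close> and \<open>gap v x\<close> are positive, then \<open>gap u x\<close> is at least their sum minus 1, hence
  positive as well.
\<close>

lemma transp_gap_pos: "transp_on A (\<lambda>u v. 0 < gap u v)"
proof (rule transp_onI)
  fix u v x
  assume "0 < gap u v" "0 < gap v x"
  then show "0 < gap u x"
    using gap_cyclic[of u v x] gap_antisym[of x u] by simp
qed

lemma asymp_gap_pos: "asymp_on A (\<lambda>u v. 0 < gap u v)"
  by (rule asymp_onI) (metis gap_antisym neg_less_0_iff_less not_less_iff_gr_or_eq)

text \<open>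
  Left multiplication by a letter moves the walk from \<open>u\<close> to \<open>v\<close> inside the tree without changing
  its edges and turns. Only when exactly one of the two words loses its first letter does the
  formula look different: then the edge at the root passes from one word to the other.
\<close>

lemma gap_letter_mult:
  assumes "reduced_word u" "reduced_word v"
  shows "gap (letter_mult d u) (letter_mult d v) = gap u v"
proof -
  have one_side: "gap u' (d # v) = gap (dual d # u') v"
    if "reduced_word (dual d # u')" "v = [] \<or> hd v \<noteq> dual d" for u' v
  proof -
    have "gap u' (d # v) = hd_turn u' [d] + (sign d + hd_turn [dual d] v + height v) - height u'"
      using that by (subst gap_distinct_heads) (cases u'; auto simp: reduced_word_Cons)+
    moreover have "gap (dual d # u') v =
      hd_turn [dual d] v + height v - (- sign d + hd_turn [d] u' + height u')"
      using that by (subst gap_distinct_heads) (cases v; auto simp: reduced_word_Cons)+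
    ultimately show ?thesis
      using hd_turn_antisym[of u' "[d]"] by simp
  qed
  show ?thesis
  proof (cases "u \<noteq> [] \<and> hd u = dual d")
    case u: True
    then have ueq: "u = dual d # tl u" by (metis list.collapse)
    show ?thesis
    proof (cases "v \<noteq> [] \<and> hd v = dual d")
      case True
      then have "v = dual d # tl v" by (metis list.collapse)
      with u True show ?thesis
        by (metis (full_types) gap.simps(1) letter_mult_def ueq)
    next
      case False
      then show ?thesis
        using one_side[of "tl u" v] u assms ueq by (auto simp: letter_mult_def)
    qed
  next
    case u: False
    show ?thesis
    proof (cases "v \<noteq> [] \<and> hd v = dual d")
      case True
      then have veq: "v = dual d # tl v" by (metis list.collapse)
      then have "gap (tl v) (d # u) = gap v u"
        using one_side[of "tl v" u] u assms by auto
      then have "gap (d # u) (tl v) = gap u v"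
        by (metis gap_antisym)
      then show ?thesis
        using True u by (auto simp: letter_mult_def)
    next
      case False
      then show ?thesis
        using u by (auto simp: letter_mult_def)
    qed
  qed
qed

lemma gap_mult_word:
  assumes "reduced_word p" "reduced_word u" "reduced_word v"
  shows "gap (mult_word p u) (mult_word p v) = gap u v"
proof -
  have reduced: "reduced_word (foldr letter_mult ps y)" if "reduced_word y" for ps y
    using that by (induction ps) (auto simp: reduced_letter_mult)
  have "gap (foldr letter_mult ps u) (foldr letter_mult ps v) = gap u v" for ps
    by (induction ps) (simp_all add: gap_letter_mult reduced assms)
  then show ?thesis
    using assms by (simp add: mult_word_conv_foldr)
qed

lemma gap_maximal:
  assumes "finite A" "A \<noteq> {}" "\<And>u. u \<in> A \<Longrightarrow> reduced_word u"
  obtains m where "m \<in> A" "\<And>u. u \<in> A \<Longrightarrow> u \<noteq> m \<Longrightarrow> 0 < gap u m"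
proof -
  obtain m where m: "m \<in> A" "\<forall>u\<in>A. u \<noteq> m \<longrightarrow> \<not> 0 < gap m u"
    using Finite_Set.bex_max_element[OF assms(1) asymp_gap_pos transp_gap_pos assms(2)] by blast
  have "0 < gap u m" if "u \<in> A" "u \<noteq> m" for u
  proof -
    have "odd (gap m u)"
      using odd_gap assms(3) m(1) that by metis
    then have "gap m u \<noteq> 0"
      by (metis even_zero)
    then show ?thesis
      using m(2) that gap_antisym[of m u] by force
  qed
  then show ?thesis
    using m(1) that by blast
qed

end

text \<open>
  Free groups have the unique product property. By left invariance the largest product with a fixed
  left factor \<open>a\<close> is \<open>a b\<close>, where \<open>b\<close> is the largest element of \<open>B\<close>. The largest of these
  products is attained only once because right multiplication by \<open>b\<close> is injective.
\<close>

theorem unique_product: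
  fixes A B :: "'b darc list set"
  assumes "finite A" "A \<noteq> {}" "finite B" "B \<noteq> {}"
    and reduced: "\<And>u. u \<in> A \<union> B \<Longrightarrow> reduced_word u"
  obtains a b where "a \<in> A" "b \<in> B"
    "\<And>a' b'. a' \<in> A \<Longrightarrow> b' \<in> B \<Longrightarrow> mult_word a' b' = mult_word a b \<Longrightarrow> a' = a \<and> b' = b"
proof -
  obtain r :: "'b darc rel" where "well_order_on UNIV r"
    using well_order_on by blast
  then interpret ordered_letters r
    by unfold_locales (simp add: well_order_on_def)
  obtain b where b: "b \<in> B" "\<And>u. u \<in> B \<Longrightarrow> u \<noteq> b \<Longrightarrow> 0 < gap u b"
    using gap_maximal[OF assms(3,4)] reduced by blast
  obtain c where c: "c \<in> (\<lambda>a. mult_word a b) ` A"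
    "\<And>u. u \<in> (\<lambda>a. mult_word a b) ` A \<Longrightarrow> u \<noteq> c \<Longrightarrow> 0 < gap u c"
    by (rule gap_maximal[of "(\<lambda>a. mult_word a b) ` A"])
      (use assms(1,2) reduced reduced_mult_word in auto)
  then obtain a where a: "a \<in> A" "c = mult_word a b"
    by blast
  have "a' = a \<and> b' = b" if "a' \<in> A" "b' \<in> B" "mult_word a' b' = mult_word a b" for a' b'
  proof -
    have le: "mult_word a' b = c \<or> 0 < gap (mult_word a' b) c"
      using c(2) that(1) by blast
    have "gap (mult_word a' b') (mult_word a' b) = gap b' b"
      by (rule gap_mult_word) (use reduced that b(1) in auto)
    then have eq: "gap (mult_word a' b) c = - gap b' b"
      using that(3) a(2) gap_antisym by metis
    have "b' = b"
    proof (rule ccontr)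
      assume "b' \<noteq> b"
      then have "0 < gap b' b"
        using b(2) that(2) by blast
      with le eq show False
        by auto
    qed
    moreover from this have "a' = a"
      using that a reduced mult_word_cancel_right by blast
    ultimately show ?thesis
      by simp
  qed
  then show ?thesis
    using that a(1) b(1) by blast
qed


section \<open>Walks in representation graphs, seen through their labels\<close>

text \<open>
  The relation \<open>joins R v d y\<close> is an edge of the double graph with its name forgotten and only its
  label \<open>d\<close> kept. In a representation graph the label determines the edge, and the relation becomes
  the partial function \<open>step\<close>; \<open>run\<close> reads a whole word.
\<close>

fun joins :: "('x, 'y, 'v, 'e) rep_graph \<Rightarrow> 'x \<Rightarrow> ('e \<times> nat) darc \<Rightarrow> 'x \<Rightarrow> bool" where
  "joins (F, \<phi>0, \<phi>1) v (Fwd a) y \<longleftrightarrow> (\<exists>f\<in>arcs F. tail F f = v \<and> head F f = y \<and> \<phi>1 f = a)"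
| "joins (F, \<phi>0, \<phi>1) v (Rev a) y \<longleftrightarrow> (\<exists>f\<in>arcs F. head F f = v \<and> tail F f = y \<and> \<phi>1 f = a)"

definition step :: "('x, 'y, 'v, 'e) rep_graph \<Rightarrow> 'x \<Rightarrow> ('e \<times> nat) darc \<Rightarrow> 'x option" where
  "step R v d = (if \<exists>y. joins R v d y then Some (THE y. joins R v d y) else None)"

primrec run :: "('x, 'y, 'v, 'e) rep_graph \<Rightarrow> 'x \<Rightarrow> ('e \<times> nat) darc list \<Rightarrow> 'x option" where
  "run R v [] = Some v"
| "run R v (d # ds) = Option.bind (step R v d) (\<lambda>y. run R y ds)"

lemma run_append: "run R v (ds @ es) = Option.bind (run R v ds) (\<lambda>y. run R y es)"
  by (induction ds arbitrary: v) (auto split: bind_split)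

lemma joins_dual: "joins R v d y \<longleftrightarrow> joins R y (dual d) v"
  by (cases R; cases d) auto

lemma joins_iff_double:
  "joins (F, \<phi>0, \<phi>1) v d y \<longleftrightarrow>
     (\<exists>g\<in>arcs (double F). tail (double F) g = v \<and> head (double F) g = y \<and> map_darc \<phi>1 g = d)"
  by (cases d) (auto simp: double_def bex_Un)

lemma double_hat_simps [simp]:
  "tail (double (hat E w)) (Fwd a) = tail E (fst a)"
  "head (double (hat E w)) (Fwd a) = head E (fst a)"
  "tail (double (hat E w)) (Rev a) = head E (fst a)"
  "head (double (hat E w)) (Rev a) = tail E (fst a)"
  by (simp_all add: double_def hat_def)

lemma path_end_Nil [simp]: "path_end G (v, []) = v"
  by (simp add: path_end_def pre_digraph.awalk_verts.simps)

lemma path_end_Cons [simp]: "path_end G (v, d # ds) = path_end G (head G d, ds)"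
  by (cases ds) (simp_all add: path_end_def pre_digraph.awalk_verts.simps)

locale weighted_rep_graph = weighted_graph E w for E :: "('v, 'e) pre_digraph" and w +
  fixes F :: "('x, 'y) pre_digraph" and \<phi>0 :: "'x \<Rightarrow> 'v" and \<phi>1 :: "'y \<Rightarrow> 'e \<times> nat"
  assumes rep: "representation_graph E w (F, \<phi>0, \<phi>1)"
begin

abbreviation R where "R \<equiv> (F, \<phi>0, \<phi>1)"

sublocale F: wf_digraph F
  using rep by (simp add: representation_graph_def)

lemma vertex_label: "v \<in> verts F \<Longrightarrow> \<phi>0 v \<in> verts E"
  using rep by (auto simp: representation_graph_def graph_hom_def hat_def)

lemma arc_label:
  assumes "f \<in> arcs F"
  shows "fst (\<phi>1 f) \<in> arcs E" "1 \<le> snd (\<phi>1 f)" "snd (\<phi>1 f) \<le> w (fst (\<phi>1 f))"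
    "\<phi>0 (tail F f) = tail E (fst (\<phi>1 f))" "\<phi>0 (head F f) = head E (fst (\<phi>1 f))"
  using rep assms by (auto simp: representation_graph_def graph_hom_def hat_def)

lemma weight_le_vertex_weight:
  assumes "e \<in> arcs E"
  shows "w e \<le> vertex_weight E w (tail E e)"
proof -
  have e: "e \<in> out_arcs E (tail E e)"
    using assms by simp
  then have "w e \<le> Max (w ` out_arcs E (tail E e))"
    using row_finite assms by (intro Max_ge) auto
  then show ?thesis
    using e by (auto simp: vertex_weight_def)
qed

lemma ex1_out_arc:
  "v \<in> verts F \<Longrightarrow> 1 \<le> i \<Longrightarrow> i \<le> vertex_weight E w (\<phi>0 v) \<Longrightarrow>
     \<exists>!f. f \<in> out_arcs F v \<and> snd (\<phi>1 f) = i"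
  using rep by (auto simp: representation_graph_def)

lemma ex1_in_arc:
  "v \<in> verts F \<Longrightarrow> e \<in> in_arcs E (\<phi>0 v) \<Longrightarrow> \<exists>!f. f \<in> in_arcs F v \<and> fst (\<phi>1 f) = e"
  using rep by (auto simp: representation_graph_def)

lemma out_arc_unique:
  assumes "f \<in> arcs F" "g \<in> arcs F" "tail F f = tail F g" "snd (\<phi>1 f) = snd (\<phi>1 g)"
  shows "f = g"
proof -
  have "snd (\<phi>1 f) \<le> vertex_weight E w (\<phi>0 (tail F f))"
    using weight_le_vertex_weight arc_label[OF assms(1)] by (metis order_trans)
  then show ?thesis
    using ex1_out_arc[of "tail F f" "snd (\<phi>1 f)"] arc_label[OF assms(1)] assms by auto
qed

lemma in_arc_unique:
  assumes "f \<in> arcs F" "g \<in> arcs F" "head F f = head F g" "fst (\<phi>1 f) = fst (\<phi>1 g)"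
  shows "f = g"
  using ex1_in_arc[of "head F f" "fst (\<phi>1 f)"] arc_label[OF assms(1)] assms by auto

lemma joins_unique: "joins R v d y \<Longrightarrow> joins R v d y' \<Longrightarrow> y = y'"
  by (cases d) (use out_arc_unique in_arc_unique in fastforce)+

lemma step_eq_Some_iff: "step R v d = Some y \<longleftrightarrow> joins R v d y"
proof -
  have "(THE y. joins R v d y) = y" if "joins R v d y" for y
    using that joins_unique by (intro the_equality) auto
  then show ?thesis
    by (auto simp: step_def simp del: joins.simps)
qed

lemma step_dual: "step R v d = Some y \<longleftrightarrow> step R y (dual d) = Some v"
  by (metis step_eq_Some_iff joins_dual)

lemma step_FwdD:
  assumes "step R v (Fwd (e, i)) = Some y"
  shows "v \<in> verts F" "y \<in> verts F" "e \<in> arcs E" "1 \<le> i" "i \<le> w e"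
    "\<phi>0 v = tail E e" "\<phi>0 y = head E e"
proof -
  obtain f where "f \<in> arcs F" "tail F f = v" "head F f = y" "\<phi>1 f = (e, i)"
    using assms by (auto simp: step_eq_Some_iff)
  with arc_label[of f] show "v \<in> verts F" "y \<in> verts F" "e \<in> arcs E" "1 \<le> i" "i \<le> w e"
    "\<phi>0 v = tail E e" "\<phi>0 y = head E e"
    by auto
qed

lemma step_RevD: "step R v (Rev a) = Some y \<Longrightarrow> step R y (Fwd a) = Some v"
  by (metis step_dual dual.simps(2))

lemma step_verts: "step R v d = Some y \<Longrightarrow> y \<in> verts F"
  by (cases d; metis step_FwdD(1,2) step_RevD surj_pair)

lemma step_labels:
  assumes "step R v d = Some y"
  shows "\<phi>0 v = tail (double (hat E w)) d" "\<phi>0 y = head (double (hat E w)) d"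
proof -
  have "\<phi>0 v = tail (double (hat E w)) d \<and> \<phi>0 y = head (double (hat E w)) d"
  proof (cases d)
    case (Fwd a)
    then show ?thesis
      using assms step_FwdD[of v "fst a" "snd a" y] by auto
  next
    case (Rev a)
    then show ?thesis
      using assms step_FwdD[of y "fst a" "snd a" v] step_RevD by auto
  qed
  then show "\<phi>0 v = tail (double (hat E w)) d" "\<phi>0 y = head (double (hat E w)) d"
    by auto
qed

lemma ex_step_Fwd:
  assumes "v \<in> verts F" "1 \<le> i" "i \<le> vertex_weight E w (\<phi>0 v)"
  obtains e y where "step R v (Fwd (e, i)) = Some y"
proof -
  obtain f where "f \<in> out_arcs F v" "snd (\<phi>1 f) = i"
    using ex1_out_arc[OF assms] by auto
  then have "joins R v (Fwd (fst (\<phi>1 f), i)) (head F f)"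
    by auto
  then show ?thesis
    using that step_eq_Some_iff by blast
qed

lemma ex_step_Rev:
  assumes "v \<in> verts F" "e \<in> arcs E" "head E e = \<phi>0 v"
  obtains i y where "step R v (Rev (e, i)) = Some y"
proof -
  obtain f where "f \<in> in_arcs F v" "fst (\<phi>1 f) = e"
    using ex1_in_arc[of v e] assms by auto
  then have "joins R v (Rev (e, snd (\<phi>1 f))) (tail F f)"
    by auto
  then show ?thesis
    using that step_eq_Some_iff by blast
qed

lemma step_Fwd_tag:
  assumes "step R v (Fwd (e, i)) = Some y" "step R v (Fwd (e', i)) = Some y'"
  shows "e = e'"
  using assms unfolding step_eq_Some_iff joins.simps by (metis out_arc_unique fst_conv snd_conv)

lemma step_Rev_st:
  assumes "step R v (Rev (e, i)) = Some y" "step R v (Rev (e, i')) = Some y'"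
  shows "i = i'"
  using assms unfolding step_eq_Some_iff joins.simps by (metis in_arc_unique fst_conv snd_conv)

lemma run_verts: "v \<in> verts F \<Longrightarrow> run R v ds = Some y \<Longrightarrow> y \<in> verts F"
  by (induction ds arbitrary: v) (auto split: bind_splits dest: step_verts)

lemma run_inj: "run R v ds = Some y \<Longrightarrow> run R v' ds = Some y \<Longrightarrow> v = v'"
proof (induction ds arbitrary: v v')
  case (Cons d ds)
  then show ?case
    by (auto split: bind_splits) (metis step_dual option.inject)
qed simp

lemma run_path_end: "run R v ds = Some y \<Longrightarrow> path_end (double (hat E w)) (\<phi>0 v, ds) = \<phi>0 y"
proof (induction ds arbitrary: v)
  case (Cons d ds)
  then obtain x where x: "step R v d = Some x" "run R x ds = Some y"
    by (auto split: bind_splits)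
  then show ?case
    using Cons.IH[of x] step_labels(2)[OF x(1)] by simp
qed simp

text \<open>
  The label of a vertex prescribes exactly one outgoing edge for every tag and exactly one
  incoming edge over every edge of \<open>E\<close>. A letter that can be read at \<open>v'\<close> but not at \<open>v\<close> would
  therefore have a competitor at \<open>v\<close>, with the same tag or over the same edge. By the inclusion
  the competitor could be read at \<open>v'\<close> as well, where there is room for only one of the two.
\<close>

lemma step_readable_mono:
  assumes "v \<in> verts F" "\<phi>0 v = \<phi>0 v'"
    and le: "\<And>d. step R v d \<noteq> None \<Longrightarrow> step R v' d \<noteq> None"
    and "step R v' d = Some y'"
  shows "step R v d \<noteq> None"
proof (cases d)
  case (Fwd a)
  obtain e i where a: "a = (e, i)" by fastforce
  have v': "step R v' (Fwd (e, i)) = Some y'"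
    using assms Fwd a by simp
  note D = step_FwdD[OF v']
  have "i \<le> vertex_weight E w (\<phi>0 v)"
    using D weight_le_vertex_weight[of e] assms by simp
  then obtain e' y where y: "step R v (Fwd (e', i)) = Some y"
    using ex_step_Fwd D assms by blast
  then obtain y'' where "step R v' (Fwd (e', i)) = Some y''"
    using le by fastforce
  then have "e' = e"
    using v' step_Fwd_tag by blast
  then show ?thesis
    using y Fwd a by simp
next
  case (Rev a)
  obtain e i where a: "a = (e, i)" by fastforce
  have v': "step R v' (Rev (e, i)) = Some y'"
    using assms Rev a by simp
  note D = step_FwdD[OF step_RevD[OF v']]
  obtain i' y where y: "step R v (Rev (e, i')) = Some y"
    using ex_step_Rev[of v e] D assms by auto
  then obtain y'' where "step R v' (Rev (e, i')) = Some y''"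
    using le by fastforce
  then have "i' = i"
    using v' step_Rev_st by blast
  then show ?thesis
    using y Rev a by simp
qed

lemma run_readable_mono:
  assumes "v \<in> verts F" "\<phi>0 v = \<phi>0 v'"
    and le: "\<And>ds. run R v ds \<noteq> None \<Longrightarrow> run R v' ds \<noteq> None"
    and "run R v' ds \<noteq> None"
  shows "run R v ds \<noteq> None"
  using assms
proof (induction ds arbitrary: v v')
  case (Cons d ds)
  obtain y' where y': "step R v' d = Some y'" "run R y' ds \<noteq> None"
    using Cons.prems(4) by (auto split: bind_splits)
  have "step R v' c \<noteq> None" if "step R v c \<noteq> None" for c
    using Cons.prems(3)[of "[c]"] that by (auto split: bind_splits)
  then obtain y where y: "step R v d = Some y"
    using step_readable_mono[OF Cons.prems(1,2) _ y'(1)] by blast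
  have "run R y es \<noteq> None \<Longrightarrow> run R y' es \<noteq> None" for es
    using Cons.prems(3)[of "d # es"] y y' by simp
  then have "run R y ds \<noteq> None"
    using Cons.IH[of y y'] y y' step_verts step_labels by metis
  then show ?case
    using y by simp
qed simp

lemma run_eq_Some_iff_awalk:
  "run R v ds = Some y \<and> v \<in> verts F \<longleftrightarrow>
     (\<exists>p. pre_digraph.awalk (double F) v p y \<and> map (map_darc \<phi>1) p = ds)"
proof (induction ds arbitrary: v)
  case Nil
  show ?case
    by (auto simp: pre_digraph.awalk_def pre_digraph.cas.simps double_def)
next
  case (Cons d ds)
  have awalk_Cons: "pre_digraph.awalk (double F) v (g # p) y \<longleftrightarrow>
      g \<in> arcs (double F) \<and> tail (double F) g = v \<and>
      pre_digraph.awalk (double F) (head (double F) g) p y" for g p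
    by (auto simp: pre_digraph.awalk_def pre_digraph.cas.simps double_def)
  have "run R v (d # ds) = Some y \<and> v \<in> verts F \<longleftrightarrow>
      (\<exists>z. joins R v d z \<and> run R z ds = Some y \<and> z \<in> verts F)"
  proof -
    have "v \<in> verts F \<and> z \<in> verts F" if "joins R v d z" for z
      using that by (cases d) auto
    then show ?thesis
      by (auto simp: step_eq_Some_iff Option.bind_eq_Some_conv simp del: joins.simps)
  qed
  also have "\<dots> \<longleftrightarrow> (\<exists>z. joins R v d z \<and>
      (\<exists>p. pre_digraph.awalk (double F) z p y \<and> map (map_darc \<phi>1) p = ds))"
    using Cons.IH by blast
  also have "\<dots> \<longleftrightarrow> (\<exists>g\<in>arcs (double F). tail (double F) g = v \<and> map_darc \<phi>1 g = d \<and>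
      (\<exists>p. pre_digraph.awalk (double F) (head (double F) g) p y \<and> map (map_darc \<phi>1) p = ds))"
    unfolding joins_iff_double by blast
  also have "\<dots> \<longleftrightarrow>
      (\<exists>g p. pre_digraph.awalk (double F) v (g # p) y \<and> map (map_darc \<phi>1) (g # p) = d # ds)"
    unfolding awalk_Cons by auto
  also have "\<dots> \<longleftrightarrow>
      (\<exists>p. pre_digraph.awalk (double F) v p y \<and> map (map_darc \<phi>1) p = d # ds)"
    by (metis map_eq_Cons_conv)
  finally show ?case .
qed

lemma map_path_image:
  assumes "u \<in> verts F"
  shows "map_path (\<phi>0, \<phi>1) ` paths_from (double F) u = {(\<phi>0 u, ds) | ds. run R u ds \<noteq> None}"
proof -
  have "map_path (\<phi>0, \<phi>1) ` paths_from (double F) u =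
      {(\<phi>0 u, ds) | ds. \<exists>y p. pre_digraph.awalk (double F) u p y \<and> map (map_darc \<phi>1) p = ds}"
    by (auto simp: paths_from_def map_path_def image_def)
  also have "\<dots> = {(\<phi>0 u, ds) | ds. run R u ds \<noteq> None}"
    using assms by (simp flip: run_eq_Some_iff_awalk)
  finally show ?thesis .
qed

text \<open>
  If the letter \<open>d\<close> cancels, the walk is shortened by its last step, which amounts to going back
  along it.
\<close>

lemma run_mult_letter:
  assumes "run R u ds = Some y"
  shows "run R u (mult_letter ds d) = step R y d"
proof (cases "ds \<noteq> [] \<and> last ds = dual d")
  case True
  then have ds: "ds = butlast ds @ [dual d]"
    by (metis append_butlast_last_id)
  have "run R u (butlast ds @ [dual d]) = Some y"
    using assms ds by simp
  then obtain z where "run R u (butlast ds) = Some z" "step R z (dual d) = Some y"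
    by (auto simp: run_append split: bind_splits)
  then show ?thesis
    using True step_dual[of y d z] by (simp add: mult_letter_def)
qed (use assms in \<open>auto simp: mult_letter_def run_append\<close>)

end


section \<open>The tree \<open>T\<close> is a representation graph\<close>

locale pointed_rep_graph = weighted_rep_graph E w F \<phi>0 \<phi>1
  for E :: "('v, 'e) pre_digraph" and w F \<phi>0 \<phi>1 +
  fixes u
  assumes u: "u \<in> verts F"
begin

definition words :: "('e \<times> nat) darc list set" where
  "words = {ds. reduced_word ds \<and> run R u ds \<noteq> None}"

abbreviation T where "T \<equiv> T_graph E w R u"
abbreviation T_verts where "T_verts \<equiv> Pair (\<phi>0 u) ` words"
abbreviation T_arcs where "T_arcs \<equiv> Pair (\<phi>0 u) ` (words - {[]})"

lemma words_Nil [simp]: "[] \<in> words"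
  by (simp add: words_def)

lemma words_run: "ds \<in> words \<Longrightarrow> \<exists>y. run R u ds = Some y"
  by (auto simp: words_def)

lemma words_snocD:
  assumes "ds @ [d] \<in> words"
  shows "ds \<in> words" "mult_letter ds d = ds @ [d]" "mult_letter (ds @ [d]) (dual d) = ds"
  using assms
  by (auto simp: words_def reduced_word_snoc run_append mult_letter_def Option.bind_eq_Some_conv)

lemma mult_letter_in_words_iff:
  assumes "ds \<in> words" "run R u ds = Some y"
  shows "mult_letter ds d \<in> words \<longleftrightarrow> step R y d \<noteq> None"
  using assms by (simp add: words_def run_mult_letter reduced_mult_letter)

lemma T_graph_eq:
  "T = (\<lparr>verts = T_verts, arcs = T_arcs,
     tail = (\<lambda>p. case last (snd p) of Fwd x \<Rightarrow> prefix_path p | Rev x \<Rightarrow> p),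
     head = (\<lambda>p. case last (snd p) of Fwd x \<Rightarrow> p | Rev x \<Rightarrow> prefix_path p)\<rparr>,
     path_end (double (hat E w)),
     (\<lambda>p. case last (snd p) of Fwd x \<Rightarrow> x | Rev x \<Rightarrow> x))"
proof -
  have "reduced_image_paths R u = T_verts"
    by (auto simp: reduced_image_paths_def map_path_image[OF u] reduced_iff_reduced_word words_def)
  moreover have "T_verts - {(\<phi>0 u, [])} = T_arcs"
    by auto
  ultimately show ?thesis
    by (simp add: T_graph_def Let_def)
qed

lemma bex_T_arcs_iff:
  "(\<exists>f\<in>T_arcs. Q f) \<longleftrightarrow>
     (\<exists>ds a. ds @ [Fwd a] \<in> words \<and> Q (\<phi>0 u, ds @ [Fwd a])) \<or>
     (\<exists>ds a. ds @ [Rev a] \<in> words \<and> Q (\<phi>0 u, ds @ [Rev a]))" (is "?L \<longleftrightarrow> ?R")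
proof
  assume ?L
  then obtain es where es: "es \<in> words" "es \<noteq> []" "Q (\<phi>0 u, es)"
    by blast
  then obtain ds d where "es = ds @ [d]"
    by (metis append_butlast_last_id)
  with es show ?R
    by (cases d) auto
next
  assume ?R
  then show ?L
    by blast
qed

lemma joins_T_iff_snoc:
  "joins T p d q \<longleftrightarrow> (\<exists>ds c. ds @ [c] \<in> words \<and>
     (c = d \<and> p = (\<phi>0 u, ds) \<and> q = (\<phi>0 u, ds @ [c]) \<or>
      c = dual d \<and> p = (\<phi>0 u, ds @ [c]) \<and> q = (\<phi>0 u, ds)))"
proof (cases d)
  case (Fwd a)
  show ?thesis
    unfolding Fwd T_graph_eq joins.simps pre_digraph.select_convs bex_T_arcs_iff
    by (auto simp: prefix_path_def simp del: split_paired_Ex split_paired_All)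
next
  case (Rev a)
  show ?thesis
    unfolding Rev T_graph_eq joins.simps pre_digraph.select_convs bex_T_arcs_iff
    by (auto simp: prefix_path_def simp del: split_paired_Ex split_paired_All)
qed

text \<open>
  An edge of \<open>T\<close> is either appended to the word of its starting point or is the last letter of that
  word, traversed backwards. Both are right multiplication by the label.
\<close>

lemma joins_T_iff:
  "joins T p d q \<longleftrightarrow>
     (\<exists>ds\<in>words. mult_letter ds d \<in> words \<and> p = (\<phi>0 u, ds) \<and> q = (\<phi>0 u, mult_letter ds d))"
    (is "?L \<longleftrightarrow> ?R")
proof
  assume ?L
  then obtain ds c where "ds @ [c] \<in> words"
    "(c = d \<and> p = (\<phi>0 u, ds) \<and> q = (\<phi>0 u, ds @ [c])) \<or>
     (c = dual d \<and> p = (\<phi>0 u, ds @ [c]) \<and> q = (\<phi>0 u, ds))"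
    unfolding joins_T_iff_snoc by blast
  then show ?R
    using words_snocD[of ds c] by auto
next
  assume ?R
  then obtain ds where ds: "ds \<in> words" "mult_letter ds d \<in> words"
    "p = (\<phi>0 u, ds)" "q = (\<phi>0 u, mult_letter ds d)"
    by blast
  show ?L
  proof (cases "ds \<noteq> [] \<and> last ds = dual d")
    case True
    then have "ds = butlast ds @ [dual d]"
      by (metis append_butlast_last_id)
    then show ?thesis
      using ds True unfolding joins_T_iff_snoc by (metis mult_letter_def)
  next
    case False
    then have "mult_letter ds d = ds @ [d]"
      by (auto simp: mult_letter_def)
    then show ?thesis
      using ds unfolding joins_T_iff_snoc by auto
  qed
qed

lemma T_arc_cases:
  assumes "f \<in> T_arcs"
  obtains ds a y z where "ds @ [Fwd a] \<in> words" "f = (\<phi>0 u, ds @ [Fwd a])"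
      "run R u ds = Some y" "joins R y (Fwd a) z" "run R u (ds @ [Fwd a]) = Some z"
  | ds a y z where "ds @ [Rev a] \<in> words" "f = (\<phi>0 u, ds @ [Rev a])"
      "run R u ds = Some y" "joins R y (Rev a) z" "run R u (ds @ [Rev a]) = Some z"
proof -
  obtain es where "es \<in> words" "es \<noteq> []" "f = (\<phi>0 u, es)"
    using assms by blast
  then obtain ds d where ds: "ds @ [d] \<in> words" "f = (\<phi>0 u, ds @ [d])"
    by (metis append_butlast_last_id)
  then obtain y z where "run R u ds = Some y" "step R y d = Some z"
    by (auto simp: words_def run_append split: bind_splits)
  then show ?thesis
    using that ds by (cases d) (auto simp: run_append step_eq_Some_iff simp del: joins.simps)
qed

text \<open>
  Sending a word to the vertex of \<open>F\<close> at which its walk from \<open>u\<close> ends is a covering: at corresponding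
  vertices the same letters can be read. Both defining properties of a representation
  graph are therefore inherited from \<open>F\<close>.
\<close>

lemma T_representation_graph: "representation_graph E w T"
proof -
  define G where "G = fst T"
  define \<xi>0 where "\<xi>0 = fst (snd T)"
  define \<xi>1 where "\<xi>1 = snd (snd T)"
  have T: "T = (G, \<xi>0, \<xi>1)"
    by (simp add: G_def \<xi>0_def \<xi>1_def)
  have G: "verts G = T_verts" "arcs G = T_arcs"
    by (simp_all add: G_def T_graph_eq)
  have \<xi>0: "\<xi>0 (\<phi>0 u, ds) = \<phi>0 y" if "run R u ds = Some y" for ds y
    using run_path_end[OF that] by (simp add: \<xi>0_def T_graph_eq)
  have snoc: "tail G (\<phi>0 u, ds @ [Fwd a]) = (\<phi>0 u, ds)"
    "head G (\<phi>0 u, ds @ [Fwd a]) = (\<phi>0 u, ds @ [Fwd a])"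
    "tail G (\<phi>0 u, ds @ [Rev a]) = (\<phi>0 u, ds @ [Rev a])"
    "head G (\<phi>0 u, ds @ [Rev a]) = (\<phi>0 u, ds)"
    "\<xi>1 (\<phi>0 u, ds @ [Fwd a]) = a" "\<xi>1 (\<phi>0 u, ds @ [Rev a]) = a" for ds a
    by (simp_all add: G_def \<xi>1_def T_graph_eq prefix_path_def)
  have arcD: "tail G f \<in> verts G \<and> head G f \<in> verts G \<and> \<xi>1 f \<in> arcs (hat E w) \<and>
      tail E (fst (\<xi>1 f)) = \<xi>0 (tail G f) \<and> head E (fst (\<xi>1 f)) = \<xi>0 (head G f)"
    if "f \<in> arcs G" for f
  proof -
    have label: "a \<in> arcs (hat E w) \<and> tail E (fst a) = \<phi>0 y \<and> head E (fst a) = \<phi>0 z"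
      if "joins R y (Fwd a) z" for y z a
      using that arc_label by (fastforce simp: hat_def)
    have "f \<in> T_arcs"
      using that by (simp add: G)
    then show ?thesis
    proof (cases rule: T_arc_cases)
      case (1 ds a y z)
      then show ?thesis
        using words_snocD[OF 1(1)] label[OF 1(4)] 1 by (simp add: snoc \<xi>0 G)
    next
      case (2 ds a y z)
      have "joins R z (Fwd a) y"
        using 2(4) by auto
      then show ?thesis
        using words_snocD[OF 2(1)] label[of z a y] 2 by (simp add: snoc \<xi>0 G)
    qed
  qed
  \<comment> \<open>An edge is named by the longer of the words at its two ends, so an end and the label determine
    it.\<close>
  define out_arc where
    "out_arc ds a = (if ds \<noteq> [] \<and> last ds = Rev a then (\<phi>0 u, ds) else (\<phi>0 u, ds @ [Fwd a]))"
    for ds and a :: "'e \<times> nat"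
  have out_eq: "f = out_arc ds (\<xi>1 f)"
    if "f \<in> arcs G" "tail G f = (\<phi>0 u, ds)" for f ds
    using that(1)[unfolded G]
  proof (cases rule: T_arc_cases)
    case (1 es a y z)
    then show ?thesis
      using that(2) by (auto simp: snoc out_arc_def words_def reduced_word_snoc simp del: joins.simps)
  next
    case (2 es a y z)
    then show ?thesis
      using that(2) by (auto simp: snoc out_arc_def simp del: joins.simps)
  qed
  define in_arc where
    "in_arc ds a = (if ds \<noteq> [] \<and> last ds = Fwd a then (\<phi>0 u, ds) else (\<phi>0 u, ds @ [Rev a]))"
    for ds and a :: "'e \<times> nat"
  have in_eq: "f = in_arc ds (\<xi>1 f)"
    if "f \<in> arcs G" "head G f = (\<phi>0 u, ds)" for f ds
    using that(1)[unfolded G]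
  proof (cases rule: T_arc_cases)
    case (1 es a y z)
    then show ?thesis
      using that(2) by (auto simp: snoc in_arc_def simp del: joins.simps)
  next
    case (2 es a y z)
    then show ?thesis
      using that(2) by (auto simp: snoc in_arc_def words_def reduced_word_snoc simp del: joins.simps)
  qed
  have joins_iff: "(\<exists>q. joins T (\<phi>0 u, ds) d q) \<longleftrightarrow> step R y d \<noteq> None"
    if "ds \<in> words" "run R u ds = Some y" for ds y d
    using that mult_letter_in_words_iff by (auto simp: joins_T_iff)
  have out: "\<exists>!f. f \<in> out_arcs G v \<and> snd (\<xi>1 f) = i"
    if v: "v \<in> verts G" and i: "1 \<le> i" "i \<le> vertex_weight E w (\<xi>0 v)" for v i
  proof -
    obtain ds y where ds: "v = (\<phi>0 u, ds)" "ds \<in> words" "run R u ds = Some y"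
      using v words_run unfolding G by blast
    have y: "y \<in> verts F" "\<xi>0 v = \<phi>0 y"
      using run_verts u ds \<xi>0 by auto
    obtain e z where e: "step R y (Fwd (e, i)) = Some z"
      using ex_step_Fwd y(1) i unfolding y(2) by blast
    then obtain q where "joins T v (Fwd (e, i)) q"
      using joins_iff[OF ds(2,3), of "Fwd (e, i)"] ds(1) by auto
    then obtain f where f: "f \<in> arcs G" "tail G f = v" "\<xi>1 f = (e, i)"
      by (auto simp: T)
    have "g = f" if g': "g \<in> out_arcs G v" "snd (\<xi>1 g) = i" for g
    proof -
      have g: "g \<in> arcs G" "tail G g = v"
        using g' by auto
      obtain e' where e': "\<xi>1 g = (e', i)"
        using g'(2) by (metis prod.collapse)
      have "joins T v (Fwd (e', i)) (head G g)"
        using g e' by (auto simp: T)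
      then have "step R y (Fwd (e', i)) \<noteq> None"
        using joins_iff[OF ds(2,3)] ds(1) by blast
      then have "e' = e"
        using step_Fwd_tag[OF _ e] by blast
      then have "\<xi>1 g = \<xi>1 f"
        using f e' by simp
      then show ?thesis
        using out_eq f g ds(1) by metis
    qed
    moreover have "f \<in> out_arcs G v \<and> snd (\<xi>1 f) = i"
      using f by simp
    ultimately show ?thesis
      by blast
  qed
  have inn: "\<exists>!f. f \<in> in_arcs G v \<and> fst (\<xi>1 f) = e"
    if v: "v \<in> verts G" and e: "e \<in> in_arcs E (\<xi>0 v)" for v e
  proof -
    obtain ds y where ds: "v = (\<phi>0 u, ds)" "ds \<in> words" "run R u ds = Some y"
      using v words_run unfolding G by blast
    have y: "y \<in> verts F" "\<xi>0 v = \<phi>0 y"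
      using run_verts u ds \<xi>0 by auto
    obtain i z where i: "step R y (Rev (e, i)) = Some z"
      using ex_step_Rev[of y e] y e by auto
    then obtain q where "joins T v (Rev (e, i)) q"
      using joins_iff[OF ds(2,3), of "Rev (e, i)"] ds(1) by auto
    then obtain f where f: "f \<in> arcs G" "head G f = v" "\<xi>1 f = (e, i)"
      by (auto simp: T)
    have "g = f" if g': "g \<in> in_arcs G v" "fst (\<xi>1 g) = e" for g
    proof -
      have g: "g \<in> arcs G" "head G g = v"
        using g' by auto
      obtain i' where i': "\<xi>1 g = (e, i')"
        using g'(2) by (metis prod.collapse)
      have "joins T v (Rev (e, i')) (tail G g)"
        using g i' by (auto simp: T)
      then have "step R y (Rev (e, i')) \<noteq> None"
        using joins_iff[OF ds(2,3)] ds(1) by blast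
      then have "i' = i"
        using step_Rev_st[OF _ i] by blast
      then have "\<xi>1 g = \<xi>1 f"
        using f i' by simp
      then show ?thesis
        using in_eq f g ds(1) by metis
    qed
    moreover have "f \<in> in_arcs G v \<and> fst (\<xi>1 f) = e"
      using f by simp
    ultimately show ?thesis
      by blast
  qed
  have "\<xi>0 v \<in> verts E" if v: "v \<in> verts G" for v
  proof -
    obtain ds y where "v = (\<phi>0 u, ds)" "run R u ds = Some y"
      using v words_run unfolding G by blast
    then show ?thesis
      using \<xi>0 vertex_label run_verts[OF u] by simp
  qed
  then have "graph_hom G (hat E w) (\<xi>0, \<xi>1)"
    unfolding graph_hom_def using arcD by (simp add: hat_def)
  moreover have "wf_digraph G"
    using arcD by unfold_locales blast+
  ultimately show ?thesis
    unfolding T representation_graph_def prod.case using out inn by blast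
qed

end


section \<open>Linear extension of maps on a basis\<close>

lemma lookup_pm_scale [simp]: "Poly_Mapping.lookup (pm_scale c x) k = c * Poly_Mapping.lookup x k"
  by (simp add: pm_scale_def Poly_Mapping.map.rep_eq when_def)

lemma vector_space_pm_scale: "vector_space (pm_scale :: 'k::field \<Rightarrow> ('a \<Rightarrow>\<^sub>0 'k) \<Rightarrow> _)"
  by unfold_locales (auto intro!: poly_mapping_eqI simp: lookup_add algebra_simps)

interpretation pm: vector_space "pm_scale :: 'k::field \<Rightarrow> ('a \<Rightarrow>\<^sub>0 'k) \<Rightarrow> _"
  by (rule vector_space_pm_scale)

lemma pm_scale_single [simp]:
  "pm_scale c (Poly_Mapping.single v d) = Poly_Mapping.single v (c * d)"
  by (rule poly_mapping_eqI) (simp add: lookup_single when_def)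

definition lin :: "('a \<Rightarrow> ('b \<Rightarrow>\<^sub>0 'k::field)) \<Rightarrow> ('a \<Rightarrow>\<^sub>0 'k) \<Rightarrow> ('b \<Rightarrow>\<^sub>0 'k)" where
  "lin f x = (\<Sum>v\<in>Poly_Mapping.keys x. pm_scale (Poly_Mapping.lookup x v) (f v))"

lemma lin_superset:
  assumes "finite S" "Poly_Mapping.keys x \<subseteq> S"
  shows "lin f x = (\<Sum>v\<in>S. pm_scale (Poly_Mapping.lookup x v) (f v))"
  unfolding lin_def using assms by (intro sum.mono_neutral_left) (auto simp: in_keys_iff)

lemma lin_zero [simp]: "lin f 0 = 0"
  by (simp add: lin_def)

lemma lin_add: "lin f (x + y) = lin f x + lin f y"
proof -
  let ?S = "Poly_Mapping.keys x \<union> Poly_Mapping.keys y"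
  have "lin f z = (\<Sum>v\<in>?S. pm_scale (Poly_Mapping.lookup z v) (f v))"
    if "Poly_Mapping.keys z \<subseteq> ?S" for z
    using that by (intro lin_superset) auto
  moreover have "Poly_Mapping.keys (x + y) \<subseteq> ?S"
    by (rule Poly_Mapping.keys_add)
  ultimately show ?thesis
    by (simp add: lookup_add pm.scale_left_distrib sum.distrib)
qed

lemma lin_scale: "lin f (pm_scale c x) = pm_scale c (lin f x)"
proof -
  have "lin f (pm_scale c x) =
      (\<Sum>v\<in>Poly_Mapping.keys x. pm_scale (Poly_Mapping.lookup (pm_scale c x) v) (f v))"
    by (rule lin_superset) (auto simp: in_keys_iff)
  then show ?thesis
    by (simp add: lin_def pm.scale_sum_right)
qed

lemma lin_uminus: "lin f (- x) = - lin f x"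
  using lin_scale[of f "-1" x] by simp

lemma lin_diff: "lin f (x - y) = lin f x - lin f y"
  using lin_add[of f x "- y"] by (simp add: lin_uminus)

lemma lin_sum: "lin f (\<Sum>i\<in>I. g i) = (\<Sum>i\<in>I. lin f (g i))"
  by (induction I rule: infinite_finite_induct) (auto simp: lin_add)

lemma lin_single [simp]: "lin f (Poly_Mapping.single v c) = pm_scale c (f v)"
  by (cases "c = 0") (simp_all add: lin_def)

lemma lin_comp: "lin g (lin f x) = lin (\<lambda>v. lin g (f v)) x"
  by (simp add: lin_def[of f] lin_def[of "\<lambda>v. lin g (f v)"] lin_sum lin_scale)

lemma lin_cong: "(\<And>v. v \<in> Poly_Mapping.keys x \<Longrightarrow> f v = g v) \<Longrightarrow> lin f x = lin g x"
  unfolding lin_def by (rule sum.cong) auto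

lemma lin_add_fun: "lin (\<lambda>v. f v + g v) x = lin f x + lin g x"
  by (simp add: lin_def pm.scale_right_distrib sum.distrib)

lemma lin_scale_fun: "lin (\<lambda>v. pm_scale c (f v)) x = pm_scale c (lin f x)"
  by (simp add: lin_def pm.scale_sum_right mult.commute)

lemma lookup_lin:
  "Poly_Mapping.lookup (lin f x) k =
     (\<Sum>v\<in>Poly_Mapping.keys x. Poly_Mapping.lookup x v * Poly_Mapping.lookup (f v) k)"
  by (simp add: lin_def lookup_sum)

lemma lin_basis: "lin (\<lambda>v. Poly_Mapping.single v 1) x = x"
proof (rule poly_mapping_eqI)
  fix k
  show "Poly_Mapping.lookup (lin (\<lambda>v. Poly_Mapping.single v 1) x) k = Poly_Mapping.lookup x k"
    by (cases "k \<in> Poly_Mapping.keys x")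
      (auto simp: lookup_lin lookup_single when_def in_keys_iff if_distrib cong: if_cong)
qed

lemma lin_in_subspace:
  assumes "pm.subspace N" "\<And>v. v \<in> Poly_Mapping.keys x \<Longrightarrow> f v \<in> N"
  shows "lin f x \<in> N"
  unfolding lin_def by (intro pm.subspace_sum pm.subspace_scale assms)

lemma pm_induct [case_names zero single add]:
  fixes a :: "'a \<Rightarrow>\<^sub>0 'k::field"
  assumes "P 0" and "\<And>m c. P (Poly_Mapping.single m c)" and "\<And>a b. P a \<Longrightarrow> P b \<Longrightarrow> P (a + b)"
  shows "P a"
proof -
  have "P (\<Sum>m\<in>I. Poly_Mapping.single m (Poly_Mapping.lookup a m))" for I
    by (induction I rule: infinite_finite_induct) (use assms in auto)
  from this[of "Poly_Mapping.keys a"] show ?thesis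
    using lin_basis[of a] by (simp add: lin_def)
qed


section \<open>The action of the free algebra\<close>

lemma gen_act_lin_eq: "gen_act_lin R x g = lin (\<lambda>v. gen_act R v g) x"
  by (simp add: gen_act_lin_def lin_def)

lemma free_act_eq: "free_act R x a = lin (\<lambda>m. foldl (gen_act_lin R) x (letters m)) a"
  by (simp add: free_act_def lin_def)

lemma word_act_eq:
  "foldl (gen_act_lin R) x gs = lin (\<lambda>v. foldl (gen_act_lin R) (Poly_Mapping.single v 1) gs) x"
proof (induction gs rule: rev_induct)
  case Nil
  show ?case by (simp add: lin_basis)
next
  case (snoc g gs)
  let ?act = "\<lambda>y. foldl (gen_act_lin R) y gs"
  have "foldl (gen_act_lin R) x (gs @ [g]) = lin (\<lambda>v. gen_act R v g) (?act x)"
    by (simp add: gen_act_lin_eq[of R _ g])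
  also have "\<dots> = lin (\<lambda>v. lin (\<lambda>v. gen_act R v g) (?act (Poly_Mapping.single v 1))) x"
    by (subst snoc) (rule lin_comp)
  finally show ?case
    by (simp add: gen_act_lin_eq[of R _ g])
qed

lemma word_act_add:
  "foldl (gen_act_lin R) (x + y) gs = foldl (gen_act_lin R) x gs + foldl (gen_act_lin R) y gs"
  using word_act_eq[of R "x + y" gs] word_act_eq[of R x gs] word_act_eq[of R y gs]
  by (simp only: lin_add)

lemma word_act_scale:
  "foldl (gen_act_lin R) (pm_scale c x) gs = pm_scale c (foldl (gen_act_lin R) x gs)"
  using word_act_eq[of R "pm_scale c x" gs] word_act_eq[of R x gs] by (simp only: lin_scale)

lemma free_act_add_left: "free_act R (x + y) a = free_act R x a + free_act R y a"
  by (simp add: free_act_eq word_act_add lin_add_fun)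

lemma free_act_scale_left: "free_act R (pm_scale c x) a = pm_scale c (free_act R x a)"
  by (simp add: free_act_eq word_act_scale lin_scale_fun)

lemma free_act_zero_left [simp]: "free_act R 0 a = 0"
  using free_act_scale_left[of R 0 0 a] by simp

lemma free_act_sum_left: "free_act R (\<Sum>i\<in>I. f i) a = (\<Sum>i\<in>I. free_act R (f i) a)"
  by (induction I rule: infinite_finite_induct) (auto simp: free_act_add_left)

lemma free_act_lin: "free_act R x a = lin (\<lambda>v. free_act R (Poly_Mapping.single v 1) a) x"
  by (subst lin_basis[of x, symmetric])
    (simp only: lin_def free_act_sum_left free_act_scale_left)

lemma free_act_zero [simp]: "free_act R x 0 = 0"
  by (simp add: free_act_eq)

lemma free_act_add: "free_act R x (a + b) = free_act R x a + free_act R x b"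
  by (simp add: free_act_eq lin_add)

lemma free_act_diff: "free_act R x (a - b) = free_act R x a - free_act R x b"
  by (simp add: free_act_eq lin_diff)

lemma free_act_scale: "free_act R x (pm_scale c a) = pm_scale c (free_act R x a)"
  by (simp add: free_act_eq lin_scale)

lemma free_act_sum: "free_act R x (\<Sum>i\<in>I. f i) = (\<Sum>i\<in>I. free_act R x (f i))"
  by (simp add: free_act_eq lin_sum)

lemma free_act_single:
  "free_act R x (Poly_Mapping.single m c) = pm_scale c (foldl (gen_act_lin R) x (letters m))"
  by (simp add: free_act_eq)

lemma letters_add: "letters (m + n) = letters m @ letters n"
  by (simp add: plus_free_word_def)

lemma free_act_mult: "free_act R x (a * b) = free_act R (free_act R x a) b"
proof (induction a rule: pm_induct)
  case (single m c)
  show ?case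
  proof (induction b rule: pm_induct)
    case (single n d)
    show ?case
      by (simp add: mult_single free_act_single letters_add word_act_scale mult.commute)
  qed (simp_all add: distrib_left free_act_add)
qed (simp_all add: distrib_right free_act_add free_act_add_left)


section \<open>Cosets of the ideal of relations\<close>

lemma lpa_free_add: "a \<in> lpa_free E w \<Longrightarrow> b \<in> lpa_free E w \<Longrightarrow> a + b \<in> lpa_free E w"
  using Poly_Mapping.keys_add[of a b] by (auto simp: lpa_free_def)

lemma lpa_free_scale: "a \<in> lpa_free E w \<Longrightarrow> pm_scale c a \<in> lpa_free E w"
  by (auto simp: lpa_free_def in_keys_iff)

lemma lpa_free_mult:
  assumes "a \<in> lpa_free E w" "b \<in> lpa_free E w"
  shows "a * b \<in> lpa_free E w"
  unfolding lpa_free_def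
proof (intro CollectI ballI)
  fix m
  assume "m \<in> Poly_Mapping.keys (a * b)"
  then obtain k l where "m = k + l" "k \<in> Poly_Mapping.keys a" "l \<in> Poly_Mapping.keys b"
    using keys_mult[of a b] by blast
  with assms show "letters m \<noteq> [] \<and> set (letters m) \<subseteq> lpa_gens E w"
    by (auto simp: lpa_free_def letters_add)
qed

lemma lpa_ideal_uminus: "a \<in> lpa_ideal E w \<Longrightarrow> - a \<in> lpa_ideal E w"
  using lpa_ideal.scale[of a E w "-1"] by simp

lemma lpa_class_self: "a \<in> lpa_free E w \<Longrightarrow> a \<in> lpa_class E w a"
  by (simp add: lpa_class_def lpa_ideal.zero)

lemma lpa_class_eqI:
  assumes "a - b \<in> lpa_ideal E w"
  shows "lpa_class E w a = lpa_class E w b"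
proof -
  have "c - a \<in> lpa_ideal E w \<longleftrightarrow> c - b \<in> lpa_ideal E w" for c
    using lpa_ideal.add[of "c - a" E w "a - b"] assms
      lpa_ideal.add[of "c - b" E w "- (a - b)"] lpa_ideal_uminus[of "a - b" E w]
    by auto
  then show ?thesis
    by (simp add: lpa_class_def)
qed

lemma LPA_add:
  assumes "a \<in> lpa_free E w" "b \<in> lpa_free E w"
  shows "alg_add (LPA E w) (lpa_class E w a) (lpa_class E w b) = lpa_class E w (a + b)"
proof -
  have eq: "lpa_class E w (a' + b') = lpa_class E w (a + b)"
    if "a' \<in> lpa_class E w a" "b' \<in> lpa_class E w b" for a' b'
  proof (rule lpa_class_eqI)
    have "(a' - a) + (b' - b) \<in> lpa_ideal E w"
      using that by (intro lpa_ideal.add) (auto simp: lpa_class_def)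
    then show "a' + b' - (a + b) \<in> lpa_ideal E w"
      by (simp add: algebra_simps)
  qed
  show ?thesis
    unfolding LPA_def nonunital_algebra.select_convs
    by (intro UN_constant_eq[OF lpa_class_self[OF assms(1)]]
        UN_constant_eq[OF lpa_class_self[OF assms(2)]] ballI eq)
qed

lemma LPA_mult:
  assumes "a \<in> lpa_free E w" "b \<in> lpa_free E w"
  shows "alg_mult (LPA E w) (lpa_class E w a) (lpa_class E w b) = lpa_class E w (a * b)"
proof -
  have eq: "lpa_class E w (a' * b') = lpa_class E w (a * b)"
    if "a' \<in> lpa_class E w a" "b' \<in> lpa_class E w b" for a' b'
  proof (rule lpa_class_eqI)
    have "a' * (b' - b) + (a' - a) * b \<in> lpa_ideal E w"
      using that assms
      by (intro lpa_ideal.add lpa_ideal.mult_left lpa_ideal.mult_right) (auto simp: lpa_class_def)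
    then show "a' * b' - a * b \<in> lpa_ideal E w"
      by (simp add: algebra_simps)
  qed
  show ?thesis
    unfolding LPA_def nonunital_algebra.select_convs
    by (intro UN_constant_eq[OF lpa_class_self[OF assms(1)]]
        UN_constant_eq[OF lpa_class_self[OF assms(2)]] ballI eq)
qed

lemma LPA_scale:
  assumes "a \<in> lpa_free E w"
  shows "alg_scale (LPA E w) c (lpa_class E w a) = lpa_class E w (pm_scale c a)"
proof -
  have eq: "lpa_class E w (pm_scale c a') = lpa_class E w (pm_scale c a)"
    if "a' \<in> lpa_class E w a" for a'
  proof (rule lpa_class_eqI)
    have "pm_scale c (a' - a) \<in> lpa_ideal E w"
      using that by (intro lpa_ideal.scale) (auto simp: lpa_class_def)
    then show "pm_scale c a' - pm_scale c a \<in> lpa_ideal E w"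
      by (simp add: pm.scale_right_diff_distrib)
  qed
  show ?thesis
    unfolding LPA_def nonunital_algebra.select_convs
    by (intro UN_constant_eq[OF lpa_class_self[OF assms]] ballI eq)
qed

lemma LPA_carrier: "alg_carrier (LPA E w) = lpa_class E w ` lpa_free E w"
  by (simp add: LPA_def)


section \<open>The module of a representation graph\<close>

primrec gen_of :: "('e \<times> nat) darc \<Rightarrow> ('v, 'e) lpa_gen" where
  "gen_of (Fwd a) = GEdge (fst a) (snd a)"
| "gen_of (Rev a) = GGhost (fst a) (snd a)"

fun basis_vec :: "'x option \<Rightarrow> 'x \<Rightarrow>\<^sub>0 'k::field" where
  "basis_vec None = 0"
| "basis_vec (Some v) = Poly_Mapping.single v 1"

context weighted_rep_graph
begin

lemma gen_act_eq_step: "gen_act R v (gen_of d) = basis_vec (step R v d)"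
proof (cases d)
  case (Fwd a)
  show ?thesis
  proof (cases "\<exists>f\<in>out_arcs F v. \<phi>1 f = a")
    case True
    then obtain f where f: "f \<in> out_arcs F v" "\<phi>1 f = a"
      by blast
    then have "(THE f. f \<in> out_arcs F v \<and> \<phi>1 f = a) = f"
      by (intro the_equality) (auto intro: out_arc_unique)
    moreover have "step R v (Fwd a) = Some (head F f)"
      using f by (auto simp: step_eq_Some_iff)
    ultimately show ?thesis
      using True Fwd by simp
  next
    case False
    then have "step R v (Fwd a) = None"
      by (auto simp: step_def)
    with False Fwd show ?thesis
      by simp
  qed
next
  case (Rev a)
  show ?thesis
  proof (cases "\<exists>f\<in>in_arcs F v. \<phi>1 f = a")
    case True
    then obtain f where f: "f \<in> in_arcs F v" "\<phi>1 f = a"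
      by blast
    then have "(THE f. f \<in> in_arcs F v \<and> \<phi>1 f = a) = f"
      by (intro the_equality) (auto intro: in_arc_unique)
    moreover have "step R v (Rev a) = Some (tail F f)"
      using f by (auto simp: step_eq_Some_iff)
    ultimately show ?thesis
      using True Rev by simp
  next
    case False
    then have "step R v (Rev a) = None"
      by (auto simp: step_def)
    with False Rev show ?thesis
      by simp
  qed
qed

lemma word_act_run:
  "foldl (gen_act_lin R) (basis_vec s :: 'x \<Rightarrow>\<^sub>0 'k::field) (map gen_of ds) =
     basis_vec (Option.bind s (\<lambda>v. run R v ds))"
proof (induction ds arbitrary: s)
  case Nil
  show ?case by (cases s) auto
next
  case (Cons d ds)
  have "gen_act_lin R (basis_vec s :: 'x \<Rightarrow>\<^sub>0 'k) (gen_of d) = basis_vec (Option.bind s (\<lambda>v. step R v d))"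
    by (cases s) (simp_all add: gen_act_lin_eq gen_act_eq_step)
  then show ?case
    by (simp add: Cons.IH)
qed

lemma carrier_eq: "V_carrier R = {x :: 'x \<Rightarrow>\<^sub>0 'k::field. Poly_Mapping.keys x \<subseteq> verts F}"
  by (simp add: V_carrier_def)

lemma subspace_carrier: "pm.subspace (V_carrier R :: ('x \<Rightarrow>\<^sub>0 'k::field) set)"
proof (rule pm.subspaceI)
  fix x y :: "'x \<Rightarrow>\<^sub>0 'k" and c
  assume "x \<in> V_carrier R" "y \<in> V_carrier R"
  then show "x + y \<in> V_carrier R"
    using Poly_Mapping.keys_add[of x y] by (auto simp: carrier_eq)
  show "pm_scale c x \<in> V_carrier R"
    using \<open>x \<in> V_carrier R\<close> by (auto simp: carrier_eq in_keys_iff)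
qed (simp add: carrier_eq)

lemma gen_act_carrier: "v \<in> verts F \<Longrightarrow> gen_act R v g \<in> V_carrier R"
proof -
  assume v: "v \<in> verts F"
  have "basis_vec (step R v d) \<in> V_carrier R" for d
    by (cases "step R v d") (auto simp: carrier_eq dest: step_verts)
  then have edge: "gen_act R v (gen_of d) \<in> V_carrier R" for d
    by (simp only: gen_act_eq_step)
  show "gen_act R v g \<in> V_carrier R"
  proof (cases g)
    case (GEdge e i)
    then show ?thesis using edge[of "Fwd (e, i)"] by simp
  next
    case (GGhost e i)
    then show ?thesis using edge[of "Rev (e, i)"] by simp
  qed (use v in \<open>simp add: carrier_eq\<close>)
qed

lemma word_act_carrier:
  assumes "x \<in> V_carrier R"
  shows "foldl (gen_act_lin R) x gs \<in> V_carrier R"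
  using assms
proof (induction gs arbitrary: x)
  case (Cons g gs)
  have "gen_act_lin R x g \<in> V_carrier R"
    unfolding gen_act_lin_eq using Cons.prems
    by (intro lin_in_subspace subspace_carrier gen_act_carrier) (auto simp: carrier_eq)
  then show ?case
    by (simp add: Cons.IH)
qed simp

lemma free_act_carrier: "x \<in> V_carrier R \<Longrightarrow> free_act R x a \<in> V_carrier R"
  unfolding free_act_eq by (intro lin_in_subspace subspace_carrier word_act_carrier)

lemma free_act_xV:
  "free_act R (basis_vec s) (xV a) =
     (case s of Some v \<Rightarrow> if \<phi>0 v = a then basis_vec (Some v) else 0 | None \<Rightarrow> 0)"
  by (cases s) (simp_all add: xV_def free_act_single gen_act_lin_eq)

text \<open>
  The convention that \<open>e\<^sub>i\<close> and \<open>e\<^sub>i\<^sup>*\<close> vanish for \<open>i\<close> beyond the weight of \<open>e\<close> agrees with the action,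
  as no vertex has an edge with such a label.
\<close>

lemma free_act_xE:
  "free_act R (basis_vec s) (xE w e i) = basis_vec (Option.bind s (\<lambda>v. step R v (Fwd (e, i))))"
proof (cases "i \<le> w e")
  case True
  then show ?thesis
    using word_act_run[of s "[Fwd (e, i)]"] by (simp add: xE_def free_act_single)
next
  case False
  then have "step R v (Fwd (e, i)) = None" for v
    using step_FwdD(5) by (metis not_None_eq)
  then show ?thesis
    using False by (cases s) (simp_all add: xE_def)
qed

lemma free_act_xG:
  "free_act R (basis_vec s) (xG w e i) = basis_vec (Option.bind s (\<lambda>v. step R v (Rev (e, i))))"
proof (cases "i \<le> w e")
  case True
  then show ?thesis
    using word_act_run[of s "[Rev (e, i)]"] by (simp add: xG_def free_act_single)
next
  case False
  then have "step R v (Rev (e, i)) = None" for v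
    using step_FwdD(5) step_RevD by (metis not_None_eq)
  then show ?thesis
    using False by (cases s) (simp_all add: xG_def)
qed

text \<open>
  In the sum below only one index contributes: at a vertex over the range of \<open>e\<close> exactly one edge
  over \<open>e\<close> arrives. If its label is \<open>e\<^sub>i\<close>, then the edge with tag \<open>i\<close> at its source is the same edge.
\<close>

lemma ghost_edge_relation:
  assumes v: "v \<in> verts F" and e: "e \<in> arcs E"
  shows "(\<Sum>i = 1..vertex_weight E w (tail E e).
      basis_vec (Option.bind (step R v (Rev (e, i))) (\<lambda>y. step R y (Fwd (f, i))))) =
    (if e = f \<and> \<phi>0 v = head E e then basis_vec (Some v) else (0 :: 'x \<Rightarrow>\<^sub>0 'k::field))"
    (is "(\<Sum>i = 1..?n. ?t i) = ?rhs")
proof (cases "\<phi>0 v = head E e")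
  case True
  obtain i y where i: "step R v (Rev (e, i)) = Some y"
    using ex_step_Rev[OF v e] True by auto
  have y: "step R y (Fwd (e, i)) = Some v"
    using step_RevD i by blast
  have "?t j = 0" if "j \<noteq> i" for j
  proof -
    have "step R v (Rev (e, j)) = None"
      using that i step_Rev_st by (metis not_None_eq)
    then show ?thesis
      by simp
  qed
  moreover have "i \<in> {1..?n}"
    using step_FwdD[OF y] weight_le_vertex_weight[OF e] by auto
  ultimately have "(\<Sum>i = 1..?n. ?t i) = ?t i"
    by (subst sum.remove[of _ i]) auto
  also have "\<dots> = ?rhs"
  proof (cases "e = f")
    case False
    then have "step R y (Fwd (f, i)) = None"
      using y step_Fwd_tag by (metis not_None_eq)
    then show ?thesis
      using False i by simp
  qed (use i y True in simp)
  finally show ?thesis .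
next
  case False
  then have "step R v (Rev (e, i)) = None" for i
    using step_FwdD(7) step_RevD by (metis not_None_eq)
  then show ?thesis
    using False by simp
qed

lemma edge_ghost_relation:
  assumes v: "v \<in> verts F" and a: "a \<in> verts E" and i: "1 \<le> i" "i \<le> vertex_weight E w a"
  shows "(\<Sum>e\<in>out_arcs E a.
      basis_vec (Option.bind (step R v (Fwd (e, i))) (\<lambda>y. step R y (Rev (e, j))))) =
    (if i = j \<and> \<phi>0 v = a then basis_vec (Some v) else (0 :: 'x \<Rightarrow>\<^sub>0 'k::field))"
    (is "sum ?t _ = ?rhs")
proof (cases "\<phi>0 v = a")
  case True
  obtain e y where e: "step R v (Fwd (e, i)) = Some y"
    using ex_step_Fwd[OF v] i True by blast
  have y: "step R y (Rev (e, i)) = Some v"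
    using e step_dual[of v "Fwd (e, i)" y] by simp
  have "?t f = 0" if "f \<noteq> e" for f
  proof -
    have "step R v (Fwd (f, i)) = None"
      using that e step_Fwd_tag by (metis not_None_eq)
    then show ?thesis
      by simp
  qed
  moreover have "e \<in> out_arcs E a"
    using step_FwdD[OF e] True by auto
  ultimately have "sum ?t (out_arcs E a) = ?t e"
    using row_finite[OF a] by (subst sum.remove[of _ e]) auto
  also have "\<dots> = ?rhs"
  proof (cases "i = j")
    case False
    then have "step R y (Rev (e, j)) = None"
      using y step_Rev_st by (metis not_None_eq)
    then show ?thesis
      using False e by simp
  qed (use e y True in simp)
  finally show ?thesis .
next
  case False
  have "?t e = 0" if "e \<in> out_arcs E a" for e
  proof -
    have "step R v (Fwd (e, i)) = None"
      using that False step_FwdD(6) by (metis in_out_arcs_conv not_None_eq)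
    then show ?thesis
      by simp
  qed
  then show ?thesis
    using False by (subst sum.neutral) auto
qed

lemma free_act_relator:
  assumes "a \<in> lpa_relators E w" "v \<in> verts F"
  shows "free_act R (basis_vec (Some v)) a = (0 :: 'x \<Rightarrow>\<^sub>0 'k::field)"
proof -
  note act = free_act_diff free_act_mult free_act_sum free_act_xV free_act_xE free_act_xG
  have fwd: "\<phi>0 x = tail E e \<and> \<phi>0 y = head E e" if "step R x (Fwd (e, i)) = Some y" for x y e i
    using step_FwdD[OF that] by simp
  have rev: "\<phi>0 x = head E e \<and> \<phi>0 y = tail E e" if "step R x (Rev (e, i)) = Some y" for x y e i
    using fwd[OF step_RevD[OF that]] by simp
  from assms(1) consider
      b c where "a = xV b * xV c - (if b = c then xV b else 0)"
    | e i where "a = xV (tail E e) * xE w e i - xE w e i"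
    | e i where "a = xE w e i * xV (head E e) - xE w e i"
    | e i where "a = xV (head E e) * xG w e i - xG w e i"
    | e i where "a = xG w e i * xV (tail E e) - xG w e i"
    | b e f where "b \<in> verts E" "e \<in> out_arcs E b" "f \<in> out_arcs E b"
        "a = (\<Sum>i = 1..vertex_weight E w b. xG w e i * xE w f i)
          - (if e = f then xV (head E e) else 0)"
    | b i j where "b \<in> verts E" "1 \<le> i" "i \<le> vertex_weight E w b"
        "a = (\<Sum>e\<in>out_arcs E b. xE w e i * xG w e j) - (if i = j then xV b else 0)"
    unfolding lpa_relators_def by blast
  then show ?thesis
  proof cases
    case 1
    then show ?thesis
      by (auto simp: free_act_diff free_act_mult free_act_xV simp del: basis_vec.simps(2))
  next
    case (2 e i)
    then show ?thesis
      by (cases "step R v (Fwd (e, i))")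
        (auto simp: act simp del: basis_vec.simps(2) dest: fwd)
  next
    case (3 e i)
    then show ?thesis
      by (cases "step R v (Fwd (e, i))")
        (auto simp: act simp del: basis_vec.simps(2) dest: fwd)
  next
    case (4 e i)
    then show ?thesis
      by (cases "step R v (Rev (e, i))")
        (auto simp: act simp del: basis_vec.simps(2) dest: rev)
  next
    case (5 e i)
    then show ?thesis
      by (cases "step R v (Rev (e, i))")
        (auto simp: act simp del: basis_vec.simps(2) dest: rev)
  next
    case (6 b e f)
    then have e: "e \<in> arcs E" "b = tail E e"
      by auto
    show ?thesis
      using ghost_edge_relation[OF assms(2) e(1), of f, where 'k = 'k]
      by (simp add: 6(4) e(2) act del: basis_vec.simps)
  next
    case (7 b i j)
    show ?thesis
      using edge_ghost_relation[OF assms(2) 7(1-3), of j, where 'k = 'k]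
      by (simp add: 7(4) act del: basis_vec.simps)
  qed
qed

lemma free_act_ideal:
  fixes x :: "'x \<Rightarrow>\<^sub>0 'k::field"
  assumes "a \<in> lpa_ideal E w" "x \<in> V_carrier R"
  shows "free_act R x a = 0"
  using assms
proof (induction arbitrary: x)
  case (relator a)
  have "free_act R (Poly_Mapping.single v 1) a = (0 :: 'x \<Rightarrow>\<^sub>0 'k)"
    if "v \<in> Poly_Mapping.keys x" for v
    using free_act_relator[OF relator(1), of v] relator(2) that by (auto simp: carrier_eq)
  then have "lin (\<lambda>v. free_act R (Poly_Mapping.single v 1) a) x = lin (\<lambda>v. 0) x"
    by (intro lin_cong)
  then show ?case
    by (subst free_act_lin) (simp add: lin_def)
qed (simp_all add: free_act_add free_act_scale free_act_mult free_act_carrier)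

lemma V_act_class:
  assumes "a \<in> lpa_free E w" "x \<in> V_carrier R"
  shows "V_act R x (lpa_class E w a) = free_act R x a"
proof -
  have eq: "free_act R x b = free_act R x a" if "b \<in> lpa_class E w a" for b
    using free_act_ideal[of "b - a" x] that assms by (auto simp: lpa_class_def free_act_diff)
  show ?thesis
    unfolding V_act_def
  proof (rule the_equality)
    fix y
    assume "\<forall>b\<in>lpa_class E w a. free_act R x b = y"
    then have "free_act R x a = y"
      using lpa_class_self[OF assms(1)] by (rule bspec)
    then show "y = free_act R x a" ..
  qed (intro ballI eq)
qed

lemma right_module_V:
  "right_module (LPA E w) (V_carrier R :: ('x \<Rightarrow>\<^sub>0 'k::field) set) pm_scale (V_act R)"
proof (intro right_module.intro vector_space_pm_scale right_module_axioms.intro subspace_carrier)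
  fix x y :: "'x \<Rightarrow>\<^sub>0 'k" and l m :: "(('v, 'e) lpa_gen, 'k) free_algebra set" and c :: 'k
  assume x: "x \<in> V_carrier R" and l: "l \<in> alg_carrier (LPA E w)"
  obtain a where a: "a \<in> lpa_free E w" "l = lpa_class E w a"
    using l by (auto simp: LPA_carrier)
  show "V_act R x l \<in> V_carrier R"
    using a x by (simp add: V_act_class free_act_carrier)
  show "V_act R (pm_scale c x) l = pm_scale c (V_act R x l)"
    using a x by (simp add: V_act_class pm.subspace_scale[OF subspace_carrier] free_act_scale_left)
  show "V_act R x (alg_scale (LPA E w) c l) = pm_scale c (V_act R x l)"
    using a x by (simp add: V_act_class LPA_scale lpa_free_scale free_act_scale)
  show "V_act R (x + y) l = V_act R x l + V_act R y l" if "y \<in> V_carrier R"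
    using a x that by (simp add: V_act_class pm.subspace_add[OF subspace_carrier] free_act_add_left)
  assume "m \<in> alg_carrier (LPA E w)"
  then obtain b where b: "b \<in> lpa_free E w" "m = lpa_class E w b"
    by (auto simp: LPA_carrier)
  show "V_act R x (alg_add (LPA E w) l m) = V_act R x l + V_act R x m"
    using a b x by (simp add: V_act_class LPA_add lpa_free_add free_act_add)
  show "V_act R x (alg_mult (LPA E w) l m) = V_act R (V_act R x l) m"
    using a b x by (simp add: V_act_class LPA_mult lpa_free_mult free_act_mult free_act_carrier)
qed

end


section \<open>Decompositions of a vertex\<close>

context weighted_rep_graph
begin

text \<open>
  The action of the vertex \<open>a\<close> followed by the letters \<open>ds\<close>. The leading vertex makes the monomial
  nonempty, so that it lies in the non-unital algebra even for the empty word \<open>ds\<close>.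
\<close>

definition walk_act :: "'v \<Rightarrow> ('e \<times> nat) darc list \<Rightarrow> ('x \<Rightarrow>\<^sub>0 'k::field) \<Rightarrow> 'x \<Rightarrow>\<^sub>0 'k" where
  "walk_act a ds x = lin (\<lambda>v. if \<phi>0 v = a then basis_vec (run R v ds) else 0) x"

lemma walk_act_add: "walk_act a ds (x + y) = walk_act a ds x + walk_act a ds y"
  by (simp add: walk_act_def lin_add)

lemma walk_act_single:
  "walk_act a ds (Poly_Mapping.single v 1) = (if \<phi>0 v = a then basis_vec (run R v ds) else 0)"
  by (simp add: walk_act_def)

lemma walk_act_eq_free_act:
  fixes x :: "'x \<Rightarrow>\<^sub>0 'k::field"
  shows "walk_act a ds x = free_act R x (Poly_Mapping.single (Word (GVert a # map gen_of ds)) 1)"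
proof -
  have "free_act R (Poly_Mapping.single v 1 :: 'x \<Rightarrow>\<^sub>0 'k)
      (Poly_Mapping.single (Word (GVert a # map gen_of ds)) 1) =
    (if \<phi>0 v = a then basis_vec (run R v ds) else 0)" for v
    using word_act_run[of "Some v" ds, where 'k = 'k] word_act_run[of None ds, where 'k = 'k]
    by (simp add: free_act_single gen_act_lin_eq[of R _ "GVert a"])
  then show ?thesis
    by (subst free_act_lin) (simp add: walk_act_def)
qed

lemma run_gens: "run R v ds = Some y \<Longrightarrow> set (map gen_of ds) \<subseteq> lpa_gens E w"
proof (induction ds arbitrary: v)
  case (Cons d ds)
  then obtain x where x: "step R v d = Some x" "run R x ds = Some y"
    by (auto split: bind_splits)
  have "gen_of d \<in> lpa_gens E w"
  proof (cases d)
    case (Fwd a)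
    then show ?thesis
      using step_FwdD[of v "fst a" "snd a" x] x by (auto simp: lpa_gens_def)
  next
    case (Rev a)
    then show ?thesis
      using step_FwdD[of x "fst a" "snd a" v] step_RevD x by (auto simp: lpa_gens_def)
  qed
  then show ?case
    using Cons.IH x by auto
qed simp

lemma submodule_walk_act:
  fixes N :: "('x \<Rightarrow>\<^sub>0 'k::field) set"
  assumes N: "right_module.submodule (LPA E w) (V_carrier R) pm_scale (V_act R) N" and x: "x \<in> N"
    and v: "v \<in> verts F" "run R v ds \<noteq> None"
  shows "walk_act (\<phi>0 v) ds x \<in> N"
proof -
  interpret V: right_module "LPA E w" "V_carrier R :: ('x \<Rightarrow>\<^sub>0 'k) set" pm_scale "V_act R"
    by (rule right_module_V)
  let ?a = "Poly_Mapping.single (Word (GVert (\<phi>0 v) # map gen_of ds)) (1 :: 'k)"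
  have "GVert (\<phi>0 v) \<in> lpa_gens E w"
    using vertex_label v(1) by (auto simp: lpa_gens_def)
  then have a: "?a \<in> lpa_free E w"
    using v(2) run_gens by (fastforce simp: lpa_free_def)
  have "V_act R x (lpa_class E w ?a) \<in> N" "x \<in> V_carrier R"
    using N x a by (auto simp: V.submodule_def LPA_carrier)
  then show ?thesis
    using a by (simp add: V_act_class walk_act_eq_free_act)
qed

lemma lookup_walk_act:
  fixes x :: "'x \<Rightarrow>\<^sub>0 'k::field"
  assumes "p \<in> Poly_Mapping.keys x" "run R p ds = Some q"
  shows "Poly_Mapping.lookup (walk_act (\<phi>0 p) ds x) q = Poly_Mapping.lookup x p"
proof -
  have "Poly_Mapping.lookup (if \<phi>0 v = \<phi>0 p then basis_vec (run R v ds) else 0) q =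
      (if v = p then 1 else 0 :: 'k)" for v
    using assms(2) run_inj[of v ds q p]
    by (cases "run R v ds") (auto simp: lookup_single when_def)
  then show ?thesis
    using assms(1) by (simp add: walk_act_def lookup_lin if_distrib[of "\<lambda>t. _ * t"] cong: if_cong)
qed

text \<open>
  A monomial that annihilates \<open>v = x + y\<close> annihilates both components because their sum is direct.
  Distinct vertices have distinct images under a monomial that does not kill them. So all
  words readable at a vertex \<open>p\<close> in the support of \<open>x\<close> are readable at \<open>v\<close>, which by
  \<open>run_readable_mono\<close> gives the converse.
\<close>

lemma component_support:
  fixes N\<^sub>1 N\<^sub>2 :: "('x \<Rightarrow>\<^sub>0 'k::field) set"
  assumes N1: "right_module.submodule (LPA E w) (V_carrier R) pm_scale (V_act R) N\<^sub>1"
    and N2: "right_module.submodule (LPA E w) (V_carrier R) pm_scale (V_act R) N\<^sub>2"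
    and disjoint: "N\<^sub>1 \<inter> N\<^sub>2 = {0}" and xy: "x \<in> N\<^sub>1" "y \<in> N\<^sub>2"
    and sum: "x + y = Poly_Mapping.single v 1" and p: "p \<in> Poly_Mapping.keys x"
  shows "\<phi>0 p = \<phi>0 v" "\<And>ds. run R v ds \<noteq> None \<Longrightarrow> run R p ds \<noteq> None"
proof -
  interpret V: right_module "LPA E w" "V_carrier R :: ('x \<Rightarrow>\<^sub>0 'k) set" pm_scale "V_act R"
    by (rule right_module_V)
  have sub: "pm.subspace N\<^sub>1" "pm.subspace N\<^sub>2" "N\<^sub>1 \<subseteq> V_carrier R"
    using N1 N2 by (auto simp: V.submodule_def)
  then have pF: "p \<in> verts F"
    using xy(1) p by (auto simp: carrier_eq)
  have readable: "\<phi>0 v = \<phi>0 p \<and> run R v ds \<noteq> None" if ds: "run R p ds \<noteq> None" for ds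
  proof (rule ccontr)
    assume "\<not> ?thesis"
    then have "walk_act (\<phi>0 p) ds (x + y) = 0"
      unfolding sum by (auto simp: walk_act_single)
    then have "walk_act (\<phi>0 p) ds x = - walk_act (\<phi>0 p) ds y"
      by (simp add: walk_act_add add_eq_0_iff2)
    moreover have "walk_act (\<phi>0 p) ds x \<in> N\<^sub>1" "- walk_act (\<phi>0 p) ds y \<in> N\<^sub>2"
      using submodule_walk_act[OF N1 xy(1) pF ds] submodule_walk_act[OF N2 xy(2) pF ds]
        pm.subspace_neg[OF sub(2)] by auto
    ultimately have "walk_act (\<phi>0 p) ds x \<in> N\<^sub>1 \<inter> N\<^sub>2"
      by (metis IntI)
    then have "walk_act (\<phi>0 p) ds x = 0"
      using disjoint by blast
    moreover obtain q where "run R p ds = Some q"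
      using ds by blast
    ultimately have "Poly_Mapping.lookup x p = 0"
      using lookup_walk_act[OF p, of ds q] by simp
    with p show False
      by (simp add: in_keys_iff)
  qed
  show "\<phi>0 p = \<phi>0 v"
    using readable[of "[]"] by simp
  then show "run R p ds \<noteq> None" if "run R v ds \<noteq> None" for ds
    using run_readable_mono[OF pF, of v ds] readable that by blast
qed

end


section \<open>Indecomposability\<close>

context pointed_rep_graph
begin

lemma step_T_iff:
  "step T p d = Some q \<longleftrightarrow>
     (\<exists>ds\<in>words. mult_letter ds d \<in> words \<and> p = (\<phi>0 u, ds) \<and> q = (\<phi>0 u, mult_letter ds d))"
proof -
  interpret T: weighted_rep_graph E w "fst T" "fst (snd T)" "snd (snd T)"
    by unfold_locales (simp add: T_representation_graph)
  show ?thesis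
    using T.step_eq_Some_iff[of p d q] by (simp add: joins_T_iff)
qed

lemma run_T_mult_word: "run T (\<phi>0 u, es) ds = Some q \<Longrightarrow> q = (\<phi>0 u, mult_word es ds)"
  by (induction ds arbitrary: es) (auto simp: step_T_iff split: bind_splits)

lemma run_T_root: "ds \<in> words \<Longrightarrow> run T (\<phi>0 u, []) ds = Some (\<phi>0 u, ds)"
proof (induction ds rule: rev_induct)
  case (snoc d ds)
  note D = words_snocD[OF snoc.prems]
  then have "step T (\<phi>0 u, ds) d = Some (\<phi>0 u, ds @ [d])"
    using snoc.prems unfolding step_T_iff by auto
  then show ?case
    using snoc.IH D(1) by (simp add: run_append)
qed simp

theorem indecomposable_T:
  "indecomposable_right_module (LPA E w) (V_carrier T :: (_ \<Rightarrow>\<^sub>0 'k::field) set) pm_scale (V_act T)"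
proof -
  obtain G \<xi>0 \<xi>1 where T: "T = (G, \<xi>0, \<xi>1)"
    by (metis prod_cases3)
  interpret T: weighted_rep_graph E w G \<xi>0 \<xi>1
    by unfold_locales (use T_representation_graph T in simp)
  have verts: "verts G = T_verts"
  proof -
    have "verts (fst T) = T_verts"
      by (simp add: T_graph_eq)
    then show ?thesis
      by (simp add: T)
  qed
  define root where "root = (\<phi>0 u, [] :: ('e \<times> nat) darc list)"
  have root: "root \<in> verts G"
    by (simp add: verts root_def)
  have run_root: "run (G, \<xi>0, \<xi>1) root (snd p) = Some p" if "p \<in> verts G" for p
    using that run_T_root by (auto simp: verts root_def T)
  have run_mult: "q = (\<phi>0 u, mult_word (snd p) ds)"
    if p: "p \<in> verts G" and run: "run (G, \<xi>0, \<xi>1) p ds = Some q" for p q ds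
  proof -
    obtain es where "p = (\<phi>0 u, es)"
      using p by (auto simp: verts)
    then show ?thesis
      using run run_T_mult_word[of es ds q] by (simp add: T)
  qed
  have reduced: "reduced_word (snd p)" if "p \<in> verts G" for p
    using that by (auto simp: verts words_def)
  interpret V: right_module "LPA E w" "V_carrier T :: (_ \<Rightarrow>\<^sub>0 'k) set" pm_scale "V_act T"
    unfolding T by (rule T.right_module_V)
  let ?root = "Poly_Mapping.single root (1 :: 'k)"
  let ?act = "T.walk_act (\<xi>0 root)"
  have act_root: "?act (snd p) ?root = Poly_Mapping.single p 1" if "p \<in> verts G" for p
    using run_root[OF that] by (simp add: T.walk_act_single)
  have act_in: "?act (snd p) x \<in> N" if "V.submodule N" "x \<in> N" "p \<in> verts G" for N x p
    using T.submodule_walk_act[of N x root "snd p"] that run_root root by (simp add: T)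
  have generates: "V_carrier T \<subseteq> N" if N: "V.submodule N" and "?root \<in> N" for N
  proof
    fix z :: "_ \<Rightarrow>\<^sub>0 'k"
    assume z: "z \<in> V_carrier T"
    have "Poly_Mapping.single p 1 \<in> N" if "p \<in> Poly_Mapping.keys z" for p
      using act_in[OF N \<open>?root \<in> N\<close>, of p] act_root[of p] that z by (auto simp: T T.carrier_eq)
    then have "lin (\<lambda>p. Poly_Mapping.single p 1) z \<in> N"
      using N by (intro lin_in_subspace) (auto simp: V.submodule_def)
    then show "z \<in> N"
      by (simp add: lin_basis)
  qed
  have root_in: "?root \<in> V_carrier T"
    using root by (simp add: T T.carrier_eq)
  show ?thesis
  proof (intro indecomposable_right_module.intro V.right_module_axioms
      indecomposable_right_module_axioms.intro)
    show "V_carrier T \<noteq> {0 :: _ \<Rightarrow>\<^sub>0 'k}"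
      using root_in by (metis lookup_single_eq lookup_zero singletonD zero_neq_one)
  next
    fix N\<^sub>1 N\<^sub>2 :: "(_ \<Rightarrow>\<^sub>0 'k) set"
    assume N1: "V.submodule N\<^sub>1" and N2: "V.submodule N\<^sub>2"
      and span: "V_carrier T = {x + y | x y. x \<in> N\<^sub>1 \<and> y \<in> N\<^sub>2}" and disjoint: "N\<^sub>1 \<inter> N\<^sub>2 = {0}"
    obtain x y where xy: "x \<in> N\<^sub>1" "y \<in> N\<^sub>2" "x + y = ?root"
      using root_in span by force
    have sub: "N\<^sub>1 \<subseteq> V_carrier T" "N\<^sub>2 \<subseteq> V_carrier T" "pm.subspace N\<^sub>1" "pm.subspace N\<^sub>2"
      using N1 N2 by (auto simp: V.submodule_def)
    have keys: "Poly_Mapping.keys x \<subseteq> verts G" "Poly_Mapping.keys y \<subseteq> verts G"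
      using sub xy by (auto simp: T T.carrier_eq)
    show "N\<^sub>1 = {0} \<or> N\<^sub>2 = {0}"
    proof (rule ccontr)
      assume nonzero: "\<not> ?thesis"
      have "x \<noteq> 0"
      proof
        assume "x = 0"
        then have "?root \<in> N\<^sub>2"
          using xy by simp
        then have "N\<^sub>1 \<subseteq> N\<^sub>2"
          using generates[OF N2] sub(1) by blast
        then show False
          using disjoint nonzero by blast
      qed
      have "y \<noteq> 0"
      proof
        assume "y = 0"
        then have "?root \<in> N\<^sub>1"
          using xy by simp
        then have "N\<^sub>2 \<subseteq> N\<^sub>1"
          using generates[OF N1] sub(2) by blast
        then show False
          using disjoint nonzero by blast
      qed
      define A where "A = snd ` Poly_Mapping.keys x"
      define B where "B = snd ` Poly_Mapping.keys y"
      obtain a b where a: "a \<in> A" and b: "b \<in> B"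
        and unique: "\<And>a' b'. a' \<in> A \<Longrightarrow> b' \<in> B \<Longrightarrow> mult_word a' b' = mult_word a b \<Longrightarrow>
          a' = a \<and> b' = b"
        by (rule unique_product[of A B])
          (use \<open>x \<noteq> 0\<close> \<open>y \<noteq> 0\<close> keys reduced in \<open>auto simp: A_def B_def\<close>)
      have in_A: "p \<in> Poly_Mapping.keys x \<Longrightarrow> snd p \<in> A" for p
        by (simp add: A_def)
      have in_B: "q \<in> Poly_Mapping.keys y \<Longrightarrow> snd q \<in> B" for q
        by (simp add: B_def)
      have pair: "p = (\<phi>0 u, snd p)" if "p \<in> verts G" for p
        using that by (auto simp: verts)
      let ?p = "(\<phi>0 u, a)" and ?q = "(\<phi>0 u, b)"
      have p: "?p \<in> Poly_Mapping.keys x" and q: "?q \<in> Poly_Mapping.keys y"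
        using a b keys by (auto simp: A_def B_def verts)
      \<comment> \<open>This is the product of \<open>x\<close> and \<open>y\<close> in the group algebra of the free group. It lies in both
        summands, but the unique product keeps it from vanishing.\<close>
      define z where "z = lin (\<lambda>q. ?act (snd q) x) y"
      have "z \<in> N\<^sub>1"
        unfolding z_def using keys by (intro lin_in_subspace sub act_in N1 xy) auto
      have "y = lin (\<lambda>q. ?act (snd q) (x + y)) y"
      proof -
        have "lin (\<lambda>q. ?act (snd q) (x + y)) y = lin (\<lambda>q. Poly_Mapping.single q 1) y"
          using keys act_root xy(3) by (intro lin_cong) auto
        then show ?thesis
          by (simp add: lin_basis)
      qed
      also have "\<dots> = z + lin (\<lambda>q. ?act (snd q) y) y"
        by (simp add: z_def T.walk_act_add lin_add_fun)
      finally have "z = y - lin (\<lambda>q. ?act (snd q) y) y"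
        by (simp add: algebra_simps)
      also have "\<dots> \<in> N\<^sub>2"
        using keys by (intro pm.subspace_diff lin_in_subspace sub act_in N2 xy) auto
      finally have "z = 0"
        using \<open>z \<in> N\<^sub>1\<close> disjoint by blast
      note support = T.component_support[OF N1[unfolded T] N2[unfolded T] disjoint xy]
      have lookup_act: "Poly_Mapping.lookup (?act (snd q) x) (\<phi>0 u, mult_word a b) =
          (if q = ?q then Poly_Mapping.lookup x ?p else 0)" if q': "q \<in> Poly_Mapping.keys y" for q
      proof (cases "q = ?q")
        case True
        have "run (G, \<xi>0, \<xi>1) ?p b \<noteq> None"
          using support(2)[OF p, of b] run_root[of ?q] q keys(2) by auto
        then obtain t where t: "run (G, \<xi>0, \<xi>1) ?p b = Some t"
          by blast
        then have "t = (\<phi>0 u, mult_word a b)"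
          using run_mult[OF _ t] p keys by auto
        then show ?thesis
          using T.lookup_walk_act[OF p t] support(1)[OF p] True by simp
      next
        case False
        have "Poly_Mapping.lookup
            (if \<xi>0 p = \<xi>0 root then basis_vec (run (G, \<xi>0, \<xi>1) p (snd q)) else 0)
            (\<phi>0 u, mult_word a b) = (0 :: 'k)" if p': "p \<in> Poly_Mapping.keys x" for p
        proof (cases "run (G, \<xi>0, \<xi>1) p (snd q)")
          case (Some t)
          then have t: "t = (\<phi>0 u, mult_word (snd p) (snd q))"
            using run_mult p' keys(1) by blast
          have "snd q \<noteq> b"
            using False pair[of q] q' keys(2) by auto
          then have "mult_word (snd p) (snd q) \<noteq> mult_word a b"
            using unique[OF in_A[OF p'] in_B[OF q']] by blast
          then show ?thesis
            using t Some by (simp add: lookup_single)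
        qed simp
        then show ?thesis
          using False by (simp add: T.walk_act_def lookup_lin)
      qed
      have "Poly_Mapping.lookup z (\<phi>0 u, mult_word a b) =
          (\<Sum>q\<in>Poly_Mapping.keys y. Poly_Mapping.lookup y q *
            (if q = ?q then Poly_Mapping.lookup x ?p else 0))"
        unfolding z_def lookup_lin using lookup_act by (intro sum.cong) auto
      also have "\<dots> = Poly_Mapping.lookup y ?q * Poly_Mapping.lookup x ?p"
        using q by (simp add: if_distrib[of "\<lambda>t. _ * t"] cong: if_cong)
      also have "\<dots> \<noteq> 0"
        using p q by (simp add: in_keys_iff)
      finally show False
        using \<open>z = 0\<close> by simp
    qed
  qed
qed

end


theorem theorem43:
  fixes E :: "('v, 'e) pre_digraph" and w :: "'e \<Rightarrow> nat"
    and C :: "('x, 'y, 'v, 'e) rep_graph set"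
    and F :: "('x, 'y) pre_digraph" and \<phi> :: "('x \<Rightarrow> 'v) \<times> ('y \<Rightarrow> 'e \<times> nat)" and u :: 'x
  assumes "weighted_graph E w"
    and "C \<in> RG E w // RG_rel E w"
    and "(F, \<phi>) \<in> C"
    and "u \<in> verts F"
  shows "indecomposable_right_module (LPA E w)
    (V_carrier (T_graph E w (F, \<phi>) u) :: (_ \<Rightarrow>\<^sub>0 'k::field) set)
    pm_scale
    (V_act (T_graph E w (F, \<phi>) u))"
proof -
  have "(F, \<phi>) \<in> RG E w"
    using assms(2,3) by (auto simp: quotient_def RG_rel_def)
  then have "representation_graph E w (F, \<phi>)"
    by (simp add: RG_def)
  then have "pointed_rep_graph E w F (fst \<phi>) (snd \<phi>) u"
    using assms(1,4)
    by (simp add: pointed_rep_graph_def weighted_rep_graph_def pointed_rep_graph_axioms_def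
        weighted_rep_graph_axioms_def)
  from pointed_rep_graph.indecomposable_T[OF this] show ?thesis
    by simp
qed

end
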